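(* Let $\mathcal X\subset\mathbb R^M$ be a connected open set and let $H_1\in C^1(\mathcal X,\operatorname{Sym}(N))$ be non-degenerate, with connected aggregate interaction graph $G(\mathcal A(\mathbf x;H_1))$ for every $\mathbf x\in\mathcal X$. Let $\ell=(\ell_e(\mathbf x))$ be an admissible active-direction selection for $H_1$, and let $T=(T(\mathbf x))_{\mathbf x\in\mathcal X}$ be a spanning tree family of $H_1$, i.e. $T(\mathbf x)$ is a spanning tree of $G(\mathcal A(\mathbf x;H_1))$ for each $\mathbf x\in\mathcal X$ (no regularity in $\mathbf x$ is required of $\ell$ or $T$). Let $\mathfrak P_{T,\ell}(\mathbf x;\cdot)$ be the invariant map induced by $H_1$, $T$, $\ell$. Then a second non-degenerate family $H_2\in C^1(\mathcal X,\operatorname{Sym}(N))$ is gauge equivalent to $H_1$, i.e. there exists a constant $Q_0\in\mathsf O(N)$ with $H_2(\mathbf x)=Q_0^{\top}H_1(\mathbf x)Q_0$ for all $\mathbf x\in\mathcal X$, if and only if $$\mathfrak P_{T,\ell}(\mathbf x;H_1)=\mathfrak P_{T,\ell}(\mathbf x;H_2)\qquad\text{for all }\mathbf x\in\mathcal X.$$ Moreover, at each $\mathbf x$ the invariant $\mathfrak P_{T,\ell}(\mathbf x;\cdot)$ comprises a total of $\mathcal O(MN^2)$ scalars (with an absolute implied constant).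
   Context: $N,M\ge 1$ are integers. $\operatorname{Sym}(N)$, $\operatorname{Skew}(N)$, $\mathsf O(N)$ denote the real symmetric, real skew-symmetric and real orthogonal $N\times N$ matrices. For $A\in\operatorname{Sym}(N)$, $\lambda_1(A)\le\dots\le\lambda_N(A)$ are its ordered eigenvalues; write $\lambda_n(\mathbf x;H)=\lambda_n(H(\mathbf x))$. A family $H:\mathcal X\to\operatorname{Sym}(N)$ is non-degenerate if $H(\mathbf x)$ has $N$ distinct eigenvalues for every $\mathbf x\in\mathcal X$. Derivative couplings. For $H\in C^1(\mathcal X,\operatorname{Sym}(N))$ non-degenerate, an ordered $C^1$ eigenframe on an open set $U\subset\mathcal X$ is $\mathbf u=(u_1,\dots,u_N)\in C^1(U,\mathsf O(N))$ with $\mathbf u^\top H\mathbf u=\operatorname{diag}(\lambda_1,\dots,\lambda_N)$, $\lambda_1<\dots<\lambda_N$ on $U$; such frames exist near every point. A pointwise derivative coupling of $H$ is a family $\mathcal A(\cdot;H)=(\mathcal A^\mu(\cdot;H))_{\mu=1}^M:\mathcal X\to\operatorname{Skew}(N)^M$ such that for each $\mathbf x$ there is an ordered $C^1$ eigenframe $\mathbf u$ in a neighbourhood of $\mathbf x$ with $\mathcal A^\mu(\mathbf x;H)=\mathbf u(\mathbf x)^\top\partial_{x_\mu}\mathbf u(\mathbf x)$ for all $\mu$. It is unique up to replacing $\mathcal A^\mu(\mathbf x;H)$ by $S(\mathbf x)\mathcal A^\mu(\mathbf x;H)S(\mathbf x)$, with $S(\mathbf x)$ diagonal with $\pm1$ entries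 and independent of $\mu$; all quantities below are independent of this choice. Interaction graph. $G(\mathcal A(\mathbf x;H))$ is the graph on vertices $V=\{1,\dots,N\}$ with edges $\{m,n\}$, $m\ne n$, such that $\mathcal A^\mu_{mn}(\mathbf x;H)\ne0$ for at least one $\mu\in\{1,\dots,M\}$. Choices induced by the reference family $H_1$. Let $E(\mathbf x)$ be the edge set of $G(\mathcal A(\mathbf x;H_1))$. An admissible active-direction selection assigns to each $\mathbf x\in\mathcal X$ and $e=\{m,n\}\in E(\mathbf x)$ a label $\ell_e(\mathbf x)\in\{1,\dots,M\}$ with $\mathcal A^{\ell_e(\mathbf x)}_{mn}(\mathbf x;H_1)\ne0$. Invariant map. For any non-degenerate $H\in C^1(\mathcal X,\operatorname{Sym}(N))$ (not necessarily $H_1$; the index sets $E(\mathbf x)$, $T(\mathbf x)$, $\ell(\mathbf x)$ always come from $H_1$), $\mathfrak P_{T,\ell}(\mathbf x;H)$ is the collection of: (1) the eigenvalues $\lambda_n(\mathbf x;H)$, $n=1,\dots,N$; (2) the pure 2-loops $\mathcal A^\mu_{mn}(\mathbf x;H)^2$ for all $1\le m<n\le N$ and $\mu=1,\dots,M$; (3) the mixed 2-loops $\mathcal A^{\ell_e(\mathbf x)}_{mn}(\mathbf x;H)\,\mathcal A^{\mu}_{mn}(\mathbf x;H)$ for all $e=\{m,n\}\in E(\mathbf x)$ and $\mu\in\{1,\dots,M\}\setminus\{\ell_e(\mathbf x)\}$; (4) the fundamental-cycle products: for each edge $e=\{p,q\}\in E(\mathbf x)$, $p<q$, not in $T(\mathbf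 x)$, with $p=v_0,v_1,\dots,v_k=q$ the unique path in $T(\mathbf x)$ from $p$ to $q$ and $f_r=\{v_{r-1},v_r\}$, the number $\Big(\prod_{r=1}^k\mathcal A^{\ell_{f_r}(\mathbf x)}_{v_{r-1}v_r}(\mathbf x;H)\Big)\mathcal A^{\ell_e(\mathbf x)}_{qp}(\mathbf x;H)$. *)

theory Defs
  imports "HOL-Analysis.Analysis"
begin

text \<open>
  The integers \<open>N\<close> and \<open>M\<close> are the cardinalities of the index types \<open>'n :: {finite, linorder}\<close>
  and \<open>'m :: finite\<close>; the linear order on \<open>'n\<close> is the order of \<open>1, \<dots>, N\<close>.
\<close>

subsection \<open>Matrix families\<close>

type_synonym 'n sq_matrix = "((real, 'n) vec, 'n) vec"

definition C1_on :: "'a::real_normed_vector set \<Rightarrow> ('a \<Rightarrow> 'b::real_normed_vector) \<Rightarrow> bool" where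
  "C1_on X f \<longleftrightarrow>
     (\<exists>f'. (\<forall>x\<in>X. (f has_derivative blinfun_apply (f' x)) (at x)) \<and> continuous_on X f')"

definition partial_deriv :: "'m \<Rightarrow> (real^'m \<Rightarrow> 'b) \<Rightarrow> real^'m \<Rightarrow> 'b::real_normed_vector" where
  "partial_deriv \<mu> f x = vector_derivative (\<lambda>t. f (x + t *\<^sub>R axis \<mu> 1)) (at 0)"

definition Sym :: "'n::finite sq_matrix set" where
  "Sym = {A. transpose A = A}"

definition Skew :: "'n::finite sq_matrix set" where
  "Skew = {A. transpose A = - A}"

definition diag :: "('n::finite \<Rightarrow> real) \<Rightarrow> 'n sq_matrix" where
  "diag d = (\<chi> i j. if i = j then d i else 0)"

definition eigenvalues :: "'n::finite sq_matrix \<Rightarrow> real set" where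
  "eigenvalues A = {c. \<exists>v. v \<noteq> 0 \<and> A *v v = c *\<^sub>R v}"

text \<open>
  The eigenvalues of a symmetric matrix, listed in nondecreasing order and repeated according
  to multiplicity: the unique nondecreasing \<open>ev\<close> whose fibre over each \<open>c\<close> has as many elements as
  the dimension of the eigenspace of \<open>c\<close> (which is \<open>0\<close> if \<open>c\<close> is not an eigenvalue).
\<close>

definition ordered_eigenvalue :: "'n::{finite,linorder} sq_matrix \<Rightarrow> 'n \<Rightarrow> real" where
  "ordered_eigenvalue A =
     (THE ev. mono ev \<and> (\<forall>c. card {n. ev n = c} = dim {v. A *v v = c *\<^sub>R v}))"

definition nondegenerate_on :: "'a set \<Rightarrow> ('a \<Rightarrow> 'n::finite sq_matrix) \<Rightarrow> bool" where
  "nondegenerate_on X H \<longleftrightarrow> (\<forall>x\<in>X. card (eigenvalues (H x)) = CARD('n))"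

definition C1_nondegenerate_family :: "(real^'m) set \<Rightarrow> (real^'m \<Rightarrow> 'n::finite sq_matrix) \<Rightarrow> bool" where
  "C1_nondegenerate_family X H \<longleftrightarrow> H \<in> X \<rightarrow> Sym \<and> C1_on X H \<and> nondegenerate_on X H"

definition gauge_equivalent ::
    "'a set \<Rightarrow> ('a \<Rightarrow> 'n::finite sq_matrix) \<Rightarrow> ('a \<Rightarrow> 'n sq_matrix) \<Rightarrow> bool" where
  "gauge_equivalent X H\<^sub>1 H\<^sub>2 \<longleftrightarrow>
     (\<exists>Q. orthogonal_matrix Q \<and> (\<forall>x\<in>X. H\<^sub>2 x = transpose Q ** H\<^sub>1 x ** Q))"

subsection \<open>Derivative couplings\<close>

definition ordered_C1_eigenframe ::
    "(real^'m) set \<Rightarrow> (real^'m \<Rightarrow> 'n::{finite,linorder} sq_matrix) \<Rightarrow> (real^'m \<Rightarrow> 'n sq_matrix) \<Rightarrow> bool" where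
  "ordered_C1_eigenframe U H u \<longleftrightarrow>
     C1_on U u \<and>
     (\<forall>y\<in>U. orthogonal_matrix (u y) \<and>
            transpose (u y) ** H y ** u y = diag (ordered_eigenvalue (H y)) \<and>
            strict_mono (ordered_eigenvalue (H y)))"

definition derivative_coupling ::
    "(real^'m) set \<Rightarrow> (real^'m \<Rightarrow> 'n::{finite,linorder} sq_matrix) \<Rightarrow> (real^'m \<Rightarrow> 'm \<Rightarrow> 'n sq_matrix) \<Rightarrow> bool" where
  "derivative_coupling X H A \<longleftrightarrow>
     (\<forall>x\<in>X. (\<forall>\<mu>. A x \<mu> \<in> Skew) \<and>
       (\<exists>U u. open U \<and> x \<in> U \<and> U \<subseteq> X \<and> ordered_C1_eigenframe U H u \<and>
              (\<forall>\<mu>. A x \<mu> = transpose (u x) ** partial_deriv \<mu> u x)))"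

subsection \<open>Graphs on the vertex set UNIV\<close>

text \<open>A graph is given by its edge set, consisting of two-element sets of vertices.\<close>

definition interaction_edges :: "('m \<Rightarrow> 'n::finite sq_matrix) \<Rightarrow> 'n set set" where
  "interaction_edges A = {{m, n} | m n. m \<noteq> n \<and> (\<exists>\<mu>. A \<mu> $ m $ n \<noteq> 0)}"

definition is_path :: "'v set set \<Rightarrow> 'v \<Rightarrow> 'v list \<Rightarrow> 'v \<Rightarrow> bool" where
  "is_path E p vs q \<longleftrightarrow>
     vs \<noteq> [] \<and> hd vs = p \<and> last vs = q \<and> distinct vs \<and>
     (\<forall>r. Suc r < length vs \<longrightarrow> {vs ! r, vs ! Suc r} \<in> E)"

definition connected_graph :: "'v set set \<Rightarrow> bool" where
  "connected_graph E \<longleftrightarrow> (\<forall>p q. \<exists>vs. is_path E p vs q)"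

definition acyclic_graph :: "'v set set \<Rightarrow> bool" where
  "acyclic_graph E \<longleftrightarrow> \<not> (\<exists>p q vs. is_path E p vs q \<and> 3 \<le> length vs \<and> {q, p} \<in> E)"

definition spanning_tree :: "'v set set \<Rightarrow> 'v set set \<Rightarrow> bool" where
  "spanning_tree T E \<longleftrightarrow> T \<subseteq> E \<and> connected_graph T \<and> acyclic_graph T"

definition tree_path :: "'v set set \<Rightarrow> 'v \<Rightarrow> 'v \<Rightarrow> 'v list" where
  "tree_path T p q = (THE vs. is_path T p vs q)"

text \<open>The values of the selection off the edge set are irrelevant.\<close>

definition active_direction_selection ::
    "'a set \<Rightarrow> ('a \<Rightarrow> 'm \<Rightarrow> 'n::finite sq_matrix) \<Rightarrow> ('a \<Rightarrow> 'n set \<Rightarrow> 'm) \<Rightarrow> bool" where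
  "active_direction_selection X A l \<longleftrightarrow>
     (\<forall>x\<in>X. \<forall>m n. {m, n} \<in> interaction_edges (A x) \<longrightarrow> A x (l x {m, n}) $ m $ n \<noteq> 0)"

subsection \<open>The invariant map\<close>

definition cycle_product ::
    "'n::finite set set \<Rightarrow> ('n set \<Rightarrow> 'm) \<Rightarrow> ('m \<Rightarrow> 'n sq_matrix) \<Rightarrow> 'n \<Rightarrow> 'n \<Rightarrow> real" where
  "cycle_product T l A p q =
     (let v = tree_path T p q in
        (\<Prod>r = 1..<length v. A (l {v ! (r - 1), v ! r}) $ (v ! (r - 1)) $ (v ! r))
        * A (l {p, q}) $ q $ p)"

datatype ('n, 'm) loop_index =
    Eigenvalue 'n
  | Pure_Loop 'n 'n 'm
  | Mixed_Loop 'n 'n 'm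
  | Fundamental_Cycle 'n 'n

text \<open>
  The collection of invariants is an indexed family of scalars, represented by its graph, so that
  equality of collections means equality index by index and the cardinality counts the scalars
  with their indices.  The arguments \<open>E\<close>, \<open>T\<close>, \<open>l\<close> are the index data at a point, induced by the
  reference family; \<open>H\<close> and \<open>A\<close> are the values at that point of a family and of its coupling.
\<close>

definition invariants ::
    "'n::{finite,linorder} set set \<Rightarrow> 'n set set \<Rightarrow> ('n set \<Rightarrow> 'm) \<Rightarrow> 'n sq_matrix \<Rightarrow> ('m \<Rightarrow> 'n sq_matrix) \<Rightarrow>
     (('n, 'm) loop_index \<times> real) set" where
  "invariants E T l H A =
     {(Eigenvalue n, ordered_eigenvalue H n) | n. True} \<union>
     {(Pure_Loop m n \<mu>, (A \<mu> $ m $ n)\<^sup>2) | m n \<mu>. m < n} \<union>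
     {(Mixed_Loop m n \<mu>, A (l {m, n}) $ m $ n * A \<mu> $ m $ n) | m n \<mu>.
        m < n \<and> {m, n} \<in> E \<and> \<mu> \<noteq> l {m, n}} \<union>
     {(Fundamental_Cycle p q, cycle_product T l A p q) | p q.
        p < q \<and> {p, q} \<in> E \<and> {p, q} \<notin> T}"

definition invariant_map ::
    "('a \<Rightarrow> 'm \<Rightarrow> 'n::{finite,linorder} sq_matrix) \<Rightarrow> ('a \<Rightarrow> 'n set set) \<Rightarrow> ('a \<Rightarrow> 'n set \<Rightarrow> 'm) \<Rightarrow> 'a \<Rightarrow>
     ('a \<Rightarrow> 'n sq_matrix) \<Rightarrow> ('a \<Rightarrow> 'm \<Rightarrow> 'n sq_matrix) \<Rightarrow> (('n, 'm) loop_index \<times> real) set" where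
  "invariant_map A\<^sub>1 T l x H A =
     invariants (interaction_edges (A\<^sub>1 x)) (T x) (l x) (H x) (A x)"

end

theory Submission
  imports Defs
begin

text \<open>
  Write \<open>u\<close> and \<open>w\<close> for local eigenframes of \<open>H\<^sub>1\<close> and \<open>H\<^sub>2\<close>, and
  \<open>B\<^sub>u = u\<^sup>T \<partial>u\<close> for the coupling of a frame.  Everything rests on one relation between
  couplings at a point, \<^emph>\<open>sign conjugacy\<close>: \<open>A\<^sub>2 = S A\<^sub>1 S\<close> in all directions, with one diagonal sign
  matrix \<open>S\<close>.

  \<^emph>\<open>Gauge equivalence gives sign conjugacy.\<close>  If \<open>H\<^sub>1 Q = Q H\<^sub>2\<close> near a point, then \<open>D = u\<^sup>T Q w\<close>
  commutes with the simple spectrum and is therefore diagonal, with signs on the diagonal.  Its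
  off-diagonal entries vanish identically, hence so do their derivatives, and this says
  \<open>B\<^sub>u D = D B\<^sub>w\<close> (\<open>frame_intertwiner\<close>).  For \<open>Q = 1\<close> this is the uniqueness of couplings up
  to signs.  For \<open>H\<^sub>1 = H\<^sub>2\<close> and a connected interaction graph it forces \<open>D\<close> to be scalar, so that the
  local commutant of the family consists of scalars (\<open>local_commutant_trivial\<close>).

  \<^emph>\<open>The invariants determine a coupling exactly up to sign conjugacy.\<close>  Apart from the
  eigenvalues, every invariant is a product along a closed walk, so the signs cancel in pairs.  Conversely, the 2-loops give
  \<open>A\<^sub>2 = \<sigma> A\<^sub>1\<close> with one sign \<open>\<sigma>\<close> for each edge, the same in all directions.  On a tree, any choice of
  edge signs has the form \<open>\<sigma>\<^sub>m\<^sub>n = s\<^sub>m s\<^sub>n\<close>, and the fundamental cycles extend this form to the chords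
  (\<open>invariants_eq_imp_sign_conjugate\<close>).

  \<^emph>\<open>Sign conjugacy at every point gives gauge equivalence.\<close>  On edges, \<open>s\<^sub>m s\<^sub>n\<close> is a quotient of
  continuous functions with values \<open>1\<close> and \<open>-1\<close>; as the graph is connected, all these products are
  locally constant, even though the signs were chosen without any regularity.  With \<open>S\<close> constant near a
  point, \<open>R = u S w\<^sup>T\<close> satisfies \<open>\<partial>R = u (B\<^sub>u S - S B\<^sub>w) w\<^sup>T = 0\<close>, so \<open>R\<close> is a
  constant orthogonal matrix, and \<open>H\<^sub>2 = R\<^sup>T H\<^sub>1 R\<close> near the point (\<open>sign_conjugate_imp_local_gauge\<close>).
  Where two such local gauges overlap, their quotient lies in the local commutant; they differ by a
  scalar sign, which conjugation does not see, so one of them serves on the whole connected domain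
  (\<open>local_gauges_glue\<close>).
\<close>

section \<open>Paths in acyclic graphs\<close>

lemma is_path_altdef:
  "is_path E p vs q \<longleftrightarrow>
     vs \<noteq> [] \<and> hd vs = p \<and> last vs = q \<and> distinct vs \<and> successively (\<lambda>a b. {a, b} \<in> E) vs"
  by (auto simp: is_path_def successively_conv_nth)

text \<open>
  Two paths with a common start agree up to some vertex \<open>a\<close>.  If they separate there, they must meet
  again because their ends coincide; following one of them to the first meeting point and the other
  one back yields a cycle.
\<close>

lemma acyclic_graph_unique_path:
  assumes "acyclic_graph E" "is_path E p vs q" "is_path E p ws q"
  shows "vs = ws"
  using assms(2,3)
proof (induction vs arbitrary: p ws)
  case Nil
  then show ?case by (simp add: is_path_def)
next
  case (Cons a vs)
  obtain ws' where ws: "ws = a # ws'"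
    using Cons.prems by (cases ws) (auto simp: is_path_altdef)
  show ?case
  proof (cases "vs = [] \<or> ws' = []")
    case True
    then show ?thesis
      using Cons.prems ws by (auto simp: is_path_altdef split: if_splits)
  next
    case False
    then have ne: "vs \<noteq> []" "ws' \<noteq> []" by auto
    have pv: "is_path E (hd vs) vs q" and pw: "is_path E (hd ws') ws' q"
      using Cons.prems ws ne by (auto simp: is_path_altdef successively_Cons)
    have av: "a \<notin> set vs" "a \<notin> set ws'" "{a, hd vs} \<in> E" "{a, hd ws'} \<in> E"
      using Cons.prems ws ne by (auto simp: is_path_altdef successively_Cons)
    show ?thesis
    proof (cases "hd vs = hd ws'")
      case True
      then show ?thesis
        using Cons.IH[OF pv] pw ws by simp
    next
      case neq: False
      have "\<exists>x\<in>set vs. x \<in> set ws'"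
      proof (rule bexI)
        show "q \<in> set ws'" "q \<in> set vs"
          using pv pw ne last_in_set[of vs] last_in_set[of ws'] by (simp_all add: is_path_def)
      qed
      then obtain vs1 z vs2 where vs: "vs = vs1 @ z # vs2" "z \<in> set ws'"
        and disj: "\<forall>y\<in>set vs1. y \<notin> set ws'"
        using split_list_first_prop[where P = "\<lambda>x. x \<in> set ws'" and xs = vs] by blast
      obtain ws1 ws2 where ws': "ws' = ws1 @ z # ws2"
        using vs(2) by (meson split_list)
      \<comment> \<open>The two paths leave \<open>a\<close> along different edges and meet again first at \<open>z\<close>; the
          resulting closed walk is a cycle.\<close>
      let ?c = "a # vs1 @ z # rev ws1"
      have "is_path E a ?c (hd ws')"
      proof -
        let ?S = "\<lambda>a b. {a, b} \<in> E"
        have sv: "successively ?S (vs1 @ z # vs2)" and sw: "successively ?S (ws1 @ z # ws2)"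
          using pv pw vs(1) ws' by (auto simp: is_path_altdef)
        have "successively ?S (vs1 @ [z])" "successively ?S (ws1 @ [z])"
          using sv sw by (simp_all add: successively_append_iff)
        moreover have "hd (vs1 @ [z]) = hd vs" using vs(1) by (cases vs1) auto
        ultimately have 1: "successively ?S ((a # vs1) @ [z])"
          using av(3) by (cases vs1) auto
        have "successively (\<lambda>x y. ?S y x) (rev (ws1 @ [z]))"
          using \<open>successively ?S (ws1 @ [z])\<close> by (simp only: successively_rev)
        moreover have "(\<lambda>x y. ?S y x) = ?S" by (simp add: insert_commute)
        ultimately have 2: "successively ?S (z # rev ws1)"
          by (simp only: rev_append rev.simps append.simps)
        have "successively ?S ((a # vs1) @ z # rev ws1)"
          using 1 2 unfolding successively_append_iff by auto
        moreover have "distinct (vs1 @ z # vs2)" "distinct (ws1 @ z # ws2)"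
          using pv pw vs(1) ws' by (auto simp: is_path_def)
        then have "distinct ?c" using av(1,2) vs(1) ws' disj by auto
        moreover have "last ?c = hd ws'" using ws' by (cases ws1) auto
        ultimately show ?thesis by (simp add: is_path_altdef)
      qed
      moreover have "3 \<le> length ?c"
      proof -
        have "vs1 \<noteq> [] \<or> ws1 \<noteq> []" using neq vs(1) ws' by auto
        then show ?thesis by (cases vs1; cases ws1) simp_all
      qed
      moreover have "{hd ws', a} \<in> E"
        using av(4) by (simp only: insert_commute)
      ultimately have "\<exists>p q vs. is_path E p vs q \<and> 3 \<le> length vs \<and> {q, p} \<in> E"
        by (intro exI conjI)
      then show ?thesis
        using assms(1)[unfolded acyclic_graph_def] by (rule notE[rotated])
    qed
  qed
qed

lemma tree_path_eqI:
  assumes "acyclic_graph E" "is_path E p vs q"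
  shows "tree_path E p q = vs"
  unfolding tree_path_def
  using assms(2) by (rule the_equality) (rule acyclic_graph_unique_path[OF assms(1) _ assms(2)])

lemma is_path_tree_path:
  assumes "acyclic_graph E" "connected_graph E"
  shows "is_path E p (tree_path E p q) q"
proof -
  obtain vs where "is_path E p vs q" using assms(2) unfolding connected_graph_def by blast
  then show ?thesis using tree_path_eqI[OF assms(1)] by simp
qed

text \<open>
  Across an edge of a tree, one of the two paths from a root extends the other one by that edge.
  This is what turns path products into a potential.
\<close>

lemma tree_path_snoc_edge:
  assumes tree: "acyclic_graph E" "connected_graph E" and e: "{m, n} \<in> E" "m \<noteq> n"
  shows "tree_path E r n = tree_path E r m @ [n] \<or> tree_path E r m = tree_path E r n @ [m]"
proof (cases "n \<in> set (tree_path E r m)")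
  case False
  then have "is_path E r (tree_path E r m @ [n]) n"
    using is_path_tree_path[OF tree, of r m] e
    by (auto simp: is_path_altdef successively_append_iff)
  then show ?thesis using tree_path_eqI[OF tree(1), of r _ n] by simp
next
  case True
  then obtain as bs where split: "tree_path E r m = as @ n # bs"
    by (meson split_list)
  have p: "is_path E r (as @ n # bs) m"
    using is_path_tree_path[OF tree, of r m] split by simp
  have pn: "is_path E r (as @ [n]) n"
    using p by (auto simp: is_path_altdef successively_append_iff successively_Cons hd_append split: if_splits)
  have "m \<notin> set (as @ [n])"
    using p e by (auto simp: is_path_altdef split: if_splits)
  then have "is_path E r (as @ [n] @ [m]) m"
    using pn e by (auto simp: is_path_altdef successively_append_iff successively_Cons hd_append insert_commute)
  then show ?thesis
    using tree_path_eqI[OF tree(1), of r "as @ [n] @ [m]" m] tree_path_eqI[OF tree(1) pn] by simp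
qed

lemma connected_graph_constant:
  assumes "connected_graph E" and step: "\<And>a b. {a, b} \<in> E \<Longrightarrow> t a = t b"
  shows "t p = t q"
proof -
  obtain vs where "is_path E p vs q"
    using assms(1) unfolding connected_graph_def by blast
  then show ?thesis
  proof (induction vs arbitrary: p)
    case (Cons a vs)
    show ?case
    proof (cases vs)
      case (Cons b bs)
      then have "is_path E b vs q" "{a, b} \<in> E" "p = a"
        using Cons.prems by (auto simp: is_path_altdef successively_Cons)
      then show ?thesis using Cons.IH[of b] step[of a b] by simp
    qed (use Cons.prems in \<open>auto simp: is_path_def\<close>)
  qed (simp add: is_path_def)
qed

section \<open>Products along paths\<close>

definition edge_product :: "('v \<Rightarrow> 'v \<Rightarrow> real) \<Rightarrow> 'v list \<Rightarrow> real" where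
  "edge_product f vs = (\<Prod>r = 1..<length vs. f (vs ! (r - 1)) (vs ! r))"

lemma edge_product_snoc:
  assumes "vs \<noteq> []"
  shows "edge_product f (vs @ [v]) = edge_product f vs * f (last vs) v"
proof -
  obtain k where k: "length vs = Suc k" using assms by (cases vs) auto
  have "edge_product f (vs @ [v]) =
      (\<Prod>r = 1..<Suc k. f ((vs @ [v]) ! (r - 1)) ((vs @ [v]) ! r))
      * f ((vs @ [v]) ! k) ((vs @ [v]) ! Suc k)"
    by (simp add: edge_product_def k)
  also have "(\<Prod>r = 1..<Suc k. f ((vs @ [v]) ! (r - 1)) ((vs @ [v]) ! r)) = edge_product f vs"
    unfolding edge_product_def k by (rule prod.cong) (auto simp: nth_append k)
  also have "(vs @ [v]) ! k = last vs"
    using assms k by (simp add: nth_append last_conv_nth)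
  also have "(vs @ [v]) ! Suc k = v"
    using k by (simp add: nth_append)
  finally show ?thesis .
qed

lemma edge_product_cong_path:
  assumes "is_path E p vs q" and "\<And>a b. {a, b} \<in> E \<Longrightarrow> f a b = g a b"
  shows "edge_product f vs = edge_product g vs"
  unfolding edge_product_def
proof (rule prod.cong)
  fix r assume "r \<in> {1..<length vs}"
  then obtain k where "r = Suc k" "Suc k < length vs" by (cases r) auto
  then show "f (vs ! (r - 1)) (vs ! r) = g (vs ! (r - 1)) (vs ! r)"
    using assms unfolding is_path_def by simp
qed simp

lemma edge_product_nonzero:
  assumes "is_path E p vs q" and "\<And>a b. {a, b} \<in> E \<Longrightarrow> f a b \<noteq> 0"
  shows "edge_product f vs \<noteq> 0"
proof
  assume "edge_product f vs = 0"
  then obtain r where "r \<in> {1..<length vs}" "f (vs ! (r - 1)) (vs ! r) = 0"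
    unfolding edge_product_def by auto
  moreover from this obtain k where k: "r = Suc k" "Suc k < length vs" by (cases r) auto
  moreover have "{vs ! k, vs ! Suc k} \<in> E"
    using assms(1) k(2) unfolding is_path_def by blast
  ultimately show False using assms(2) by simp
qed

text \<open>
  The vertex signs telescope: each inner vertex of the path contributes its sign twice.
\<close>

lemma edge_product_gauge:
  assumes "vs \<noteq> []" "\<And>n. s n * s n = 1"
  shows "edge_product (\<lambda>a b. s a * s b * f a b) vs = s (hd vs) * s (last vs) * edge_product f vs"
  using assms(1)
proof (induction vs rule: rev_nonempty_induct)
  case (single x)
  then show ?case by (simp add: edge_product_def assms)
next
  case (snoc x xs)
  have "s (hd xs) * s (last xs) * edge_product f xs * (s (last xs) * s x * f (last xs) x)
      = s (hd xs) * (s (last xs) * s (last xs)) * s x * (edge_product f xs * f (last xs) x)"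
    by (simp only: mult_ac)
  also have "\<dots> = s (hd (xs @ [x])) * s (last (xs @ [x])) * edge_product f (xs @ [x])"
    using snoc.hyps by (simp add: edge_product_snoc assms(2))
  finally show ?case
    by (simp only: edge_product_snoc[OF snoc.hyps] snoc.IH)
qed

lemma cycle_product_eq:
  "cycle_product T l A p q =
     edge_product (\<lambda>a b. A (l {a, b}) $ a $ b) (tree_path T p q) * A (l {p, q}) $ q $ p"
  by (simp add: cycle_product_def edge_product_def Let_def)

text \<open>
  A tree has no cycles that could obstruct integrating edge signs: the product of the edge signs along
  the path from a root is a potential for them.
\<close>

lemma tree_sign_potential:
  fixes f :: "'v \<Rightarrow> 'v \<Rightarrow> real"
  assumes tree: "acyclic_graph T" "connected_graph T"
    and no_loop: "\<And>a. {a} \<notin> T"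
    and sign: "\<And>a b. {a, b} \<in> T \<Longrightarrow> f a b * f a b = 1"
    and symm: "\<And>a b. f a b = f b a"
  obtains s where "\<And>n. s n * s n = 1" "\<And>a b. {a, b} \<in> T \<Longrightarrow> f a b = s a * s b"
proof
  fix r :: 'v
  define s where "s n = edge_product f (tree_path T r n)" for n
  note path = is_path_tree_path[OF tree, of r]
  have sq: "s n * s n = 1" for n
  proof -
    have "s n * s n = edge_product (\<lambda>a b. f a b * f a b) (tree_path T r n)"
      unfolding s_def edge_product_def by (simp add: prod.distrib)
    also have "\<dots> = edge_product (\<lambda>a b. 1) (tree_path T r n)"
      by (rule edge_product_cong_path[OF path]) (rule sign)
    finally show ?thesis by (simp add: edge_product_def)
  qed
  show "s n * s n = 1" for n by (fact sq)
  show "f a b = s a * s b" if e: "{a, b} \<in> T" for a b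
  proof -
    have "a \<noteq> b" using e no_loop by auto
    have ne: "tree_path T r n \<noteq> []" "last (tree_path T r n) = n" for n
      using path[of n] unfolding is_path_def by auto
    consider "tree_path T r b = tree_path T r a @ [b]" | "tree_path T r a = tree_path T r b @ [a]"
      using tree_path_snoc_edge[OF tree e \<open>a \<noteq> b\<close>] by blast
    then show ?thesis
    proof cases
      case 1
      then have "s b = s a * f a b" using ne unfolding s_def by (simp add: edge_product_snoc)
      then show ?thesis using sq[of a] by (simp flip: mult.assoc)
    next
      case 2
      then have "s a = s b * f a b" using ne symm[of a b] unfolding s_def by (simp add: edge_product_snoc)
      then show ?thesis using sq[of b] by (simp add: mult.commute mult.left_commute)
    qed
  qed
qed

section \<open>Sign conjugate couplings\<close>

text \<open>
  This is conjugation by a diagonal matrix of signs \<open>s\<close> that does not depend on the direction \<open>\<mu>\<close>,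
  that is, the remaining freedom in the choice of a pointwise derivative coupling.
\<close>

definition sign_conjugate :: "('m \<Rightarrow> 'n::finite sq_matrix) \<Rightarrow> ('m \<Rightarrow> 'n sq_matrix) \<Rightarrow> bool" where
  "sign_conjugate A B \<longleftrightarrow>
     (\<exists>s. (\<forall>n. s n * s n = 1) \<and> (\<forall>\<mu> m n. B \<mu> $ m $ n = s m * s n * A \<mu> $ m $ n))"

lemma sign_conjugate_sym:
  assumes "sign_conjugate A B" shows "sign_conjugate B A"
proof -
  obtain s where s: "\<And>n. s n * s n = 1" "\<And>\<mu> m n. B \<mu> $ m $ n = s m * s n * A \<mu> $ m $ n"
    using assms unfolding sign_conjugate_def by blast
  have "s m * s n * (s m * s n * A \<mu> $ m $ n) = (s m * s m) * (s n * s n) * A \<mu> $ m $ n" for \<mu> m n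
    by (simp only: mult_ac)
  then show ?thesis
    unfolding sign_conjugate_def using s by (intro exI[of _ s]) simp
qed

lemma sign_conjugate_trans:
  assumes "sign_conjugate A B" "sign_conjugate B C" shows "sign_conjugate A C"
proof -
  obtain s where s: "\<And>n. s n * s n = 1" "\<And>\<mu> m n. B \<mu> $ m $ n = s m * s n * A \<mu> $ m $ n"
    using assms(1) unfolding sign_conjugate_def by blast
  obtain t where t: "\<And>n. t n * t n = 1" "\<And>\<mu> m n. C \<mu> $ m $ n = t m * t n * B \<mu> $ m $ n"
    using assms(2) unfolding sign_conjugate_def by blast
  have "(s n * t n) * (s n * t n) = (s n * s n) * (t n * t n)" for n
    by (simp only: mult_ac)
  then show ?thesis
    unfolding sign_conjugate_def using s t by (intro exI[of _ "\<lambda>n. s n * t n"]) simp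
qed

lemma Skew_nth:
  assumes "A \<in> Skew"
  shows "A $ n $ m = - A $ m $ n"
proof -
  have "transpose A $ m $ n = (- A) $ m $ n" using assms by (simp add: Skew_def)
  then show ?thesis by (simp add: transpose_def)
qed

lemma interaction_edges_iff:
  assumes "\<And>\<mu>. A \<mu> \<in> Skew"
  shows "{m, n} \<in> interaction_edges A \<longleftrightarrow> (\<exists>\<mu>. A \<mu> $ m $ n \<noteq> 0)"
proof
  assume "{m, n} \<in> interaction_edges A"
  then obtain a b \<mu> where ab: "{m, n} = {a, b}" "A \<mu> $ a $ b \<noteq> 0"
    unfolding interaction_edges_def by blast
  then have "A \<mu> $ m $ n \<noteq> 0"
    using Skew_nth[OF assms, of \<mu> m n] by (auto simp: doubleton_eq_iff)
  then show "\<exists>\<mu>. A \<mu> $ m $ n \<noteq> 0" ..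
next
  assume "\<exists>\<mu>. A \<mu> $ m $ n \<noteq> 0"
  moreover have "A \<mu> $ m $ m = 0" for \<mu>
    using Skew_nth[OF assms, of \<mu> m m] by simp
  ultimately have "m \<noteq> n" "\<exists>\<mu>. A \<mu> $ m $ n \<noteq> 0" by auto
  then show "{m, n} \<in> interaction_edges A"
    unfolding interaction_edges_def by blast
qed

lemma interaction_edges_no_loop: "{a} \<notin> interaction_edges A"
  unfolding interaction_edges_def by (auto simp: doubleton_eq_iff)

section \<open>The invariants determine a coupling up to signs\<close>

text \<open>
  Each scalar carries its index, so equality of the two graphs can be read off index by index.
\<close>

lemma invariants_eq_iff:
  "invariants E T l H A = invariants E T l H' A' \<longleftrightarrow>
     (\<forall>n. ordered_eigenvalue H n = ordered_eigenvalue H' n) \<and>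
     (\<forall>m n \<mu>. m < n \<longrightarrow> (A \<mu> $ m $ n)\<^sup>2 = (A' \<mu> $ m $ n)\<^sup>2) \<and>
     (\<forall>m n \<mu>. m < n \<and> {m, n} \<in> E \<and> \<mu> \<noteq> l {m, n} \<longrightarrow>
        A (l {m, n}) $ m $ n * A \<mu> $ m $ n = A' (l {m, n}) $ m $ n * A' \<mu> $ m $ n) \<and>
     (\<forall>p q. p < q \<and> {p, q} \<in> E \<and> {p, q} \<notin> T \<longrightarrow> cycle_product T l A p q = cycle_product T l A' p q)"
  (is "?L \<longleftrightarrow> ?R")
proof
  assume eq: ?L
  have "(i, v) \<in> invariants E T l H A \<longleftrightarrow> (i, v) \<in> invariants E T l H' A'" for i v
    using eq by simp
  note mem = this[unfolded invariants_def]
  show ?R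
  proof (intro conjI allI impI)
    show "ordered_eigenvalue H n = ordered_eigenvalue H' n" for n
      using mem[of "Eigenvalue n"] by auto
    show "(A \<mu> $ m $ n)\<^sup>2 = (A' \<mu> $ m $ n)\<^sup>2" if "m < n" for m n \<mu>
      using mem[of "Pure_Loop m n \<mu>"] that by auto
    show "A (l {m, n}) $ m $ n * A \<mu> $ m $ n = A' (l {m, n}) $ m $ n * A' \<mu> $ m $ n"
      if "m < n \<and> {m, n} \<in> E \<and> \<mu> \<noteq> l {m, n}" for m n \<mu>
      using mem[of "Mixed_Loop m n \<mu>"] that by auto
    show "cycle_product T l A p q = cycle_product T l A' p q"
      if "p < q \<and> {p, q} \<in> E \<and> {p, q} \<notin> T" for p q
      using mem[of "Fundamental_Cycle p q"] that by auto
  qed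
next
  assume ?R
  then show ?L
    unfolding invariants_def
    by (intro arg_cong2[where f = "(\<union>)"] Collect_cong ex_cong1 rev_conj_cong refl) auto
qed

text \<open>
  A conjugating sign enters a 2-loop twice at each of its vertices.  Along a fundamental cycle the
  tree path leaves the signs of its two ends, and the chord cancels them.
\<close>

lemma invariants_sign_conjugate:
  assumes tree: "spanning_tree T E"
    and ev: "ordered_eigenvalue H = ordered_eigenvalue H'" and "sign_conjugate A A'"
  shows "invariants E T l H A = invariants E T l H' A'"
proof -
  obtain s where s: "\<And>n. s n * s n = 1" "\<And>\<mu> m n. A' \<mu> $ m $ n = s m * s n * A \<mu> $ m $ n"
    using assms unfolding sign_conjugate_def by blast
  have two: "s m * s n * x * (s m * s n * y) = x * y" for m n x y
  proof -
    have "s m * s n * x * (s m * s n * y) = (s m * s m) * (s n * s n) * (x * y)"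
      by (simp only: mult_ac)
    then show ?thesis by (simp add: s)
  qed
  have "cycle_product T l A p q = cycle_product T l A' p q" for p q
  proof -
    let ?f = "\<lambda>a b. A (l {a, b}) $ a $ b" and ?v = "tree_path T p q"
    have v: "?v \<noteq> []" "hd ?v = p" "last ?v = q"
      using is_path_tree_path[of T p q] tree unfolding spanning_tree_def is_path_def by auto
    have "cycle_product T l A' p q
        = s p * s q * edge_product ?f ?v * (s q * s p * A (l {p, q}) $ q $ p)"
      unfolding cycle_product_eq s(2) edge_product_gauge[OF v(1) s(1)] v ..
    also have "\<dots> = s p * s q * edge_product ?f ?v * (s p * s q * A (l {p, q}) $ q $ p)"
      by (simp only: mult_ac)
    finally show ?thesis by (simp add: two cycle_product_eq)
  qed
  then show ?thesis
    unfolding invariants_eq_iff by (simp add: ev s(2) two power2_eq_square)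
qed

text \<open>
  The pure 2-loop in the active direction of an edge gives the ratio \<open>f\<close> of the two couplings up to
  sign; the mixed 2-loops show that this ratio is the same in all directions.  A potential \<open>s\<close> for \<open>f\<close>
  on the tree then works on every chord, since the cycle product compares \<open>f\<close> on the chord with
  \<open>s\<close> at its ends.  Off the interaction graph the pure 2-loops force both couplings to vanish.
\<close>

lemma invariants_eq_imp_sign_conjugate:
  fixes A A' :: "'m \<Rightarrow> 'n::{finite,linorder} sq_matrix"
  assumes tree: "spanning_tree T (interaction_edges A)"
    and skew: "\<And>\<mu>. A \<mu> \<in> Skew" "\<And>\<mu>. A' \<mu> \<in> Skew"
    and active: "\<And>m n. {m, n} \<in> interaction_edges A \<Longrightarrow> A (l {m, n}) $ m $ n \<noteq> 0"
    and eq: "invariants (interaction_edges A) T l H A = invariants (interaction_edges A) T l H' A'"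
  shows "sign_conjugate A A'"
proof -
  let ?E = "interaction_edges A"
  define f where "f m n = A' (l {m, n}) $ m $ n / A (l {m, n}) $ m $ n" for m n
  have symm: "f m n = f n m" for m n
    using Skew_nth[OF skew(1), of _ m n] Skew_nth[OF skew(2), of _ m n]
    by (simp add: f_def insert_commute)
  have pure: "(A \<mu> $ m $ n)\<^sup>2 = (A' \<mu> $ m $ n)\<^sup>2" for \<mu> m n
  proof (cases m n rule: linorder_cases)
    case less
    then show ?thesis using eq unfolding invariants_eq_iff by blast
  next
    case greater
    then have "(A \<mu> $ n $ m)\<^sup>2 = (A' \<mu> $ n $ m)\<^sup>2" using eq unfolding invariants_eq_iff by blast
    then show ?thesis
      using Skew_nth[OF skew(1), of \<mu> m n] Skew_nth[OF skew(2), of \<mu> m n] by simp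
  qed (use Skew_nth[OF skew(1), of \<mu> m m] Skew_nth[OF skew(2), of \<mu> m m] in simp)
  have f_sq: "f m n * f m n = 1" if "{m, n} \<in> ?E" for m n
  proof -
    have "(f m n)\<^sup>2 = (A' (l {m, n}) $ m $ n)\<^sup>2 / (A (l {m, n}) $ m $ n)\<^sup>2"
      by (simp add: f_def power_divide)
    also have "\<dots> = 1" unfolding pure[symmetric] using active[OF that] by simp
    finally show ?thesis by (simp add: power2_eq_square)
  qed
  have less_edge: "A' \<mu> $ m $ n = f m n * A \<mu> $ m $ n" if "m < n" "{m, n} \<in> ?E" for \<mu> m n
  proof (cases "\<mu> = l {m, n}")
    case True
    then show ?thesis using active[OF that(2)] by (simp add: f_def)
  next
    case False
    let ?a = "A (l {m, n}) $ m $ n" and ?a' = "A' (l {m, n}) $ m $ n"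
    have "?a * A \<mu> $ m $ n = ?a' * A' \<mu> $ m $ n"
      using eq that False unfolding invariants_eq_iff by blast
    moreover have "?a' = f m n * ?a" using active[OF that(2)] by (simp add: f_def)
    ultimately have "?a * A \<mu> $ m $ n = ?a * (f m n * A' \<mu> $ m $ n)" by simp
    then have "A \<mu> $ m $ n = f m n * A' \<mu> $ m $ n" using active[OF that(2)] by simp
    then show ?thesis using f_sq[OF that(2)] by (metis mult.assoc mult_1)
  qed
  have edge: "A' \<mu> $ m $ n = f m n * A \<mu> $ m $ n" if "{m, n} \<in> ?E" for \<mu> m n
  proof (cases m n rule: linorder_cases)
    case less
    then show ?thesis using less_edge that by blast
  next
    case equal
    then show ?thesis using that interaction_edges_no_loop[of m A] by simp
  next
    case greater
    then show ?thesis using less_edge[of n m \<mu>] that symm[of m n]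
        Skew_nth[OF skew(1), of \<mu> m n] Skew_nth[OF skew(2), of \<mu> m n] by (simp add: insert_commute)
  qed
  have T: "T \<subseteq> ?E" "acyclic_graph T" "connected_graph T"
    using tree unfolding spanning_tree_def by auto
  obtain s where s: "\<And>n. s n * s n = 1" and sT: "\<And>a b. {a, b} \<in> T \<Longrightarrow> f a b = s a * s b"
  proof (rule tree_sign_potential[OF T(2,3), of f])
    show "{a} \<notin> T" for a using T(1) interaction_edges_no_loop by blast
    show "f a b * f a b = 1" if "{a, b} \<in> T" for a b using that T(1) f_sq by blast
    show "f a b = f b a" for a b by (fact symm)
  qed blast
  \<comment> \<open>The tree path contributes \<open>s p * s q\<close> to the quotient of the two cycle products.\<close>
  have chord: "f p q = s p * s q" if "p < q" "{p, q} \<in> ?E" "{p, q} \<notin> T" for p q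
  proof -
    let ?g = "\<lambda>a b. A (l {a, b}) $ a $ b" and ?g' = "\<lambda>a b. A' (l {a, b}) $ a $ b"
      and ?v = "tree_path T p q"
    have path: "is_path T p ?v q" using is_path_tree_path[OF T(2,3)] .
    have v: "?v \<noteq> []" "hd ?v = p" "last ?v = q" using path unfolding is_path_def by auto
    have "edge_product ?g' ?v = edge_product (\<lambda>a b. s a * s b * ?g a b) ?v"
      by (rule edge_product_cong_path[OF path]) (use edge sT T(1) in force)
    also have "\<dots> = s p * s q * edge_product ?g ?v"
      unfolding edge_product_gauge[OF v(1) s] v ..
    finally have "cycle_product T l A' p q
        = (s p * s q * f q p) * (edge_product ?g ?v * A (l {p, q}) $ q $ p)"
      using edge[of q p "l {p, q}"] that by (simp add: cycle_product_eq insert_commute)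
    moreover have "cycle_product T l A p q = cycle_product T l A' p q"
      using eq that unfolding invariants_eq_iff by blast
    moreover have "edge_product ?g ?v * A (l {p, q}) $ q $ p \<noteq> 0"
      using edge_product_nonzero[OF path, of ?g] active[of q p] that T(1) active
      by (auto simp: insert_commute)
    ultimately have "s p * s q * f q p = 1" by (simp add: cycle_product_eq)
    then have "(s p * s p) * (s q * s q) * f q p = s p * s q" by (simp add: mult.assoc mult.left_commute)
    then show ?thesis by (simp add: s symm[of q p])
  qed
  have fs: "f m n = s m * s n" if "{m, n} \<in> ?E" for m n
  proof (cases m n rule: linorder_cases)
    case less
    then show ?thesis using chord sT that by blast
  next
    case equal
    then show ?thesis using that interaction_edges_no_loop[of m A] by simp
  next
    case greater
    have "f n m = s n * s m" using chord[OF greater] sT[of n m] that by (metis insert_commute)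
    then show ?thesis using symm[of m n] by simp
  qed
  have "A' \<mu> $ m $ n = s m * s n * A \<mu> $ m $ n" for \<mu> m n
  proof (cases "{m, n} \<in> ?E")
    case True
    then show ?thesis using edge fs by simp
  next
    case False
    then have "A \<mu> $ m $ n = 0" using interaction_edges_iff[of A m n] skew by auto
    then show ?thesis using pure[of \<mu> m n] by simp
  qed
  then show ?thesis unfolding sign_conjugate_def using s by blast
qed

section \<open>The number of invariants\<close>

text \<open>
  The indices inject into the triples of a direction and two vertices.  Pure 2-loops take the pairs above
  the diagonal, eigenvalues the diagonal in one arbitrary direction.  Below the diagonal, a mixed 2-loop never uses the active
  direction of its edge, and that free slot holds the fundamental cycle of the edge.
\<close>

lemma card_invariants:
  fixes A :: "'m::finite \<Rightarrow> 'n::{finite,linorder} sq_matrix"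
  shows "finite (invariants E T l H A)"
    and "card (invariants E T l H A) \<le> CARD('m) * CARD('n)\<^sup>2"
proof -
  define code :: "('n, 'm) loop_index \<times> real \<Rightarrow> 'm \<times> 'n \<times> 'n" where
    "code = (\<lambda>(i, _). case i of
       Eigenvalue n \<Rightarrow> (undefined, n, n)
     | Pure_Loop m n \<mu> \<Rightarrow> (\<mu>, m, n)
     | Mixed_Loop m n \<mu> \<Rightarrow> (\<mu>, n, m)
     | Fundamental_Cycle p q \<Rightarrow> (l {p, q}, q, p))"
  have inj: "inj_on code (invariants E T l H A)"
    unfolding inj_on_def invariants_def code_def by auto
  show "finite (invariants E T l H A)"
    using inj by (rule inj_on_finite[where B = UNIV]) auto
  have "card (invariants E T l H A) \<le> card (UNIV :: ('m \<times> 'n \<times> 'n) set)"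
    using inj by (rule card_inj_on_le) auto
  then show "card (invariants E T l H A) \<le> CARD('m) * CARD('n)\<^sup>2"
    by (simp add: card_cartesian_product power2_eq_square flip: UNIV_Times_UNIV)
qed

section \<open>Calculus of matrix-valued functions\<close>

lemma bounded_bilinear_matrix_mult:
  "bounded_bilinear ((**) :: real^'k^'m \<Rightarrow> real^'n^'k \<Rightarrow> real^'n^'m)"
  by (rule bilinear_conv_bounded_bilinear[THEN iffD1])
    (auto simp: bilinear_def linear_iff matrix_matrix_mult_def vec_eq_iff
       algebra_simps sum.distrib sum_distrib_left)

lemma bounded_linear_transpose: "bounded_linear (transpose :: real^'n^'m \<Rightarrow> real^'m^'n)"
  by (rule linear_conv_bounded_linear[THEN iffD1]) (auto simp: linear_iff transpose_def vec_eq_iff)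

lemma partial_deriv_eq:
  assumes "(f has_derivative f') (at x)"
  shows "partial_deriv \<mu> f x = f' (axis \<mu> 1)"
proof -
  have f: "(f has_derivative f') (at (x + 0 *\<^sub>R axis \<mu> 1))" using assms by simp
  have line: "((\<lambda>t::real. x + t *\<^sub>R axis \<mu> 1) has_derivative (\<lambda>t. t *\<^sub>R axis \<mu> 1)) (at 0)"
    by (auto intro!: derivative_eq_intros)
  have "((\<lambda>t. f (x + t *\<^sub>R axis \<mu> 1)) has_derivative (\<lambda>t. f' (t *\<^sub>R axis \<mu> 1))) (at 0)"
    using has_derivative_compose[OF line f] .
  then have "((\<lambda>t. f (x + t *\<^sub>R axis \<mu> 1)) has_vector_derivative f' (axis \<mu> 1)) (at 0)"
    unfolding has_vector_derivative_def
    using bounded_linear.linear[OF has_derivative_bounded_linear[OF assms]]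
    by (simp add: linear_cmul)
  then show ?thesis
    unfolding partial_deriv_def by (rule vector_derivative_at)
qed

lemma partial_deriv_linear:
  assumes "f differentiable (at x)" "bounded_linear L"
  shows "partial_deriv \<mu> (\<lambda>y. L (f y)) x = L (partial_deriv \<mu> f x)"
proof -
  obtain f' where f: "(f has_derivative f') (at x)"
    using assms(1) unfolding differentiable_def by blast
  show ?thesis
    using partial_deriv_eq[OF bounded_linear.has_derivative[OF assms(2) f]] partial_deriv_eq[OF f]
    by simp
qed

lemma partial_deriv_matrix_mult:
  fixes f :: "real^'m \<Rightarrow> real^'k^'i" and g :: "real^'m \<Rightarrow> real^'j^'k"
  assumes "f differentiable (at x)" "g differentiable (at x)"
  shows "(\<lambda>y. f y ** g y) differentiable (at x)"
    and "partial_deriv \<mu> (\<lambda>y. f y ** g y) x = partial_deriv \<mu> f x ** g x + f x ** partial_deriv \<mu> g x"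
proof -
  obtain f' g' where f: "(f has_derivative f') (at x)" and g: "(g has_derivative g') (at x)"
    using assms unfolding differentiable_def by blast
  note fg = bounded_bilinear.FDERIV[OF bounded_bilinear_matrix_mult f g]
  show "(\<lambda>y. f y ** g y) differentiable (at x)"
    using fg unfolding differentiable_def by blast
  show "partial_deriv \<mu> (\<lambda>y. f y ** g y) x = partial_deriv \<mu> f x ** g x + f x ** partial_deriv \<mu> g x"
    using partial_deriv_eq[OF fg] partial_deriv_eq[OF f] partial_deriv_eq[OF g]
    by (simp add: add.commute)
qed

lemma partial_deriv_locally_constant:
  assumes "f differentiable (at x)" "open W" "x \<in> W" "\<And>y. y \<in> W \<Longrightarrow> f y = c"
  shows "partial_deriv \<mu> f x = 0"
proof -
  obtain f' where "(f has_derivative f') (at x)"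
    using assms(1) unfolding differentiable_def by blast
  then have "((\<lambda>y. c) has_derivative f') (at x)"
    by (rule has_derivative_transform_within_open) (use assms in auto)
  then have "f' = (\<lambda>h. 0)"
    by (rule has_derivative_unique) simp
  then show ?thesis
    using partial_deriv_eq[OF \<open>(f has_derivative f') (at x)\<close>] by simp
qed

lemma zero_partial_derivs_imp_constant:
  fixes f :: "real^'m \<Rightarrow> 'b::real_normed_vector"
  assumes "convex W" "open W"
    and "\<And>y. y \<in> W \<Longrightarrow> f differentiable (at y)"
    and zero: "\<And>y \<mu>. y \<in> W \<Longrightarrow> partial_deriv \<mu> f y = 0"
    and "x \<in> W" "y \<in> W"
  shows "f x = f y"
proof (rule has_derivative_zero_unique[OF assms(1)])
  fix z assume z: "z \<in> W"
  obtain f' where f: "(f has_derivative f') (at z)"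
    using assms(3)[OF z] unfolding differentiable_def by blast
  have lin: "linear f'" using f has_derivative_bounded_linear bounded_linear.linear by blast
  have "f' h = 0" for h
  proof -
    have "f' h = f' (\<Sum>i\<in>UNIV. (h $ i) *\<^sub>R axis i 1)"
      using basis_expansion[of h] by (simp add: scalar_mult_eq_scaleR)
    also have "\<dots> = (\<Sum>i\<in>UNIV. (h $ i) *\<^sub>R f' (axis i 1))"
      by (simp add: linear_sum[OF lin] linear_cmul[OF lin])
    finally show ?thesis using zero[OF z] partial_deriv_eq[OF f] by simp
  qed
  then have "f' = (\<lambda>h. 0)" by auto
  then show "(f has_derivative (\<lambda>h. 0)) (at z within W)"
    using f has_derivative_at_withinI by blast
qed (use assms in auto)

lemma C1_on_differentiable: "C1_on U f \<Longrightarrow> x \<in> U \<Longrightarrow> f differentiable (at x)"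
  unfolding C1_on_def differentiable_def by blast

lemma C1_on_continuous_partial_deriv:
  assumes "C1_on U f"
  shows "continuous_on U (partial_deriv \<mu> f)"
proof -
  obtain f' where f': "\<And>x. x \<in> U \<Longrightarrow> (f has_derivative blinfun_apply (f' x)) (at x)"
    and cont: "continuous_on U f'"
    using assms unfolding C1_on_def by blast
  have "continuous_on U (\<lambda>x. blinfun_apply (f' x) (axis \<mu> 1))"
    by (intro continuous_intros cont)
  then show ?thesis
    by (rule continuous_on_cong[THEN iffD1, rotated -1]) (auto simp: partial_deriv_eq[OF f'])
qed

lemma C1_on_subset: "C1_on U f \<Longrightarrow> V \<subseteq> U \<Longrightarrow> C1_on V f"
  unfolding C1_on_def by (meson continuous_on_subset subsetD)

section \<open>Diagonal and orthogonal matrices\<close>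

lemma diag_mult_nth: "(diag d ** A) $ m $ n = d m * A $ m $ n"
  unfolding diag_def matrix_matrix_mult_def
  by (simp add: if_distrib[where f = "\<lambda>x. x * _"] cong: if_cong)

lemma mult_diag_nth: "(A ** diag d) $ m $ n = A $ m $ n * d n"
  unfolding diag_def matrix_matrix_mult_def
  by (simp add: if_distrib[where f = "\<lambda>x. _ * x"] cong: if_cong)

lemma transpose_diag: "transpose (diag d) = diag d"
  unfolding diag_def transpose_def vec_eq_iff by simp

lemma orthogonal_matrixD:
  assumes "orthogonal_matrix Q"
  shows "transpose Q ** Q = mat 1" "Q ** transpose Q = mat 1"
    "transpose Q ** (Q ** A) = A" "Q ** (transpose Q ** A) = A"
  using assms unfolding orthogonal_matrix_def by (simp_all add: matrix_mul_assoc)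

text \<open>
  The ordered spectrum is described through the dimensions of the eigenspaces alone, and \<open>Q\<close> maps the
  eigenspaces of \<open>Q\<^sup>T H Q\<close> onto those of \<open>H\<close>.
\<close>

lemma ordered_eigenvalue_orthogonal_conjugate:
  assumes "orthogonal_matrix Q"
  shows "ordered_eigenvalue (transpose Q ** H ** Q) = ordered_eigenvalue H"
proof -
  have "dim {v. (transpose Q ** H ** Q) *v v = c *\<^sub>R v} = dim {v. H *v v = c *\<^sub>R v}" for c
  proof -
    have "{v. H *v v = c *\<^sub>R v} = (*v) Q ` {v. (transpose Q ** H ** Q) *v v = c *\<^sub>R v}"
    proof (intro subset_antisym subsetI)
      fix v assume v: "v \<in> {v. H *v v = c *\<^sub>R v}"
      have "v = Q *v (transpose Q *v v)"
        using orthogonal_matrixD(2)[OF assms]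
        by (simp add: matrix_vector_mul_assoc del: transpose_matrix_vector)
      moreover have "(transpose Q ** H ** Q) *v (transpose Q *v v) = c *\<^sub>R (transpose Q *v v)"
      proof -
        have "transpose Q ** H ** Q ** transpose Q = transpose Q ** H"
          by (simp add: orthogonal_matrixD(2)[OF assms] flip: matrix_mul_assoc)
        then have "(transpose Q ** H ** Q) *v (transpose Q *v v) = transpose Q *v (H *v v)"
          by (simp add: matrix_vector_mul_assoc del: transpose_matrix_vector)
        then show ?thesis
          using v by (simp add: matrix_vector_mult_scaleR del: transpose_matrix_vector)
      qed
      ultimately show "v \<in> (*v) Q ` {v. (transpose Q ** H ** Q) *v v = c *\<^sub>R v}" by blast
    next
      fix w assume "w \<in> (*v) Q ` {v. (transpose Q ** H ** Q) *v v = c *\<^sub>R v}"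
      then obtain v where v: "w = Q *v v" "(transpose Q ** H ** Q) *v v = c *\<^sub>R v" by auto
      have "Q *v ((transpose Q ** H ** Q) *v v) = H *v w"
        by (simp add: v(1) matrix_vector_mul_assoc orthogonal_matrixD[OF assms] flip: matrix_mul_assoc)
      then show "w \<in> {v. H *v v = c *\<^sub>R v}"
        using v by (simp add: matrix_vector_mult_scaleR)
    qed
    moreover have "inj ((*v) Q)"
    proof (rule injI)
      fix a b assume "Q *v a = Q *v b"
      then have "transpose Q *v (Q *v a) = transpose Q *v (Q *v b)" by simp
      then show "a = b"
        unfolding matrix_vector_mul_assoc orthogonal_matrixD(1)[OF assms] by simp
    qed
    then have "dim ((*v) Q ` S) = dim S" for S
      by (intro dim_image_eq matrix_vector_mul_linear) (auto intro: inj_on_subset)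
    ultimately show ?thesis by simp
  qed
  then show ?thesis unfolding ordered_eigenvalue_def by simp
qed

section \<open>Eigenframes and their couplings\<close>

definition frame_coupling :: "(real^'m \<Rightarrow> 'n::finite sq_matrix) \<Rightarrow> real^'m \<Rightarrow> 'm \<Rightarrow> 'n sq_matrix" where
  "frame_coupling u x \<mu> = transpose (u x) ** partial_deriv \<mu> u x"

lemma ordered_C1_eigenframe_subset:
  "ordered_C1_eigenframe U H u \<Longrightarrow> V \<subseteq> U \<Longrightarrow> ordered_C1_eigenframe V H u"
  unfolding ordered_C1_eigenframe_def using C1_on_subset by blast

lemma frame_eigen_equation:
  assumes "ordered_C1_eigenframe U H u" "y \<in> U"
  shows "H y ** u y = u y ** diag (ordered_eigenvalue (H y))"
proof -
  have "orthogonal_matrix (u y)" "transpose (u y) ** H y ** u y = diag (ordered_eigenvalue (H y))"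
    using assms unfolding ordered_C1_eigenframe_def by auto
  then show ?thesis
    by (metis matrix_mul_assoc orthogonal_matrixD(4))
qed

lemma partial_deriv_frame:
  assumes "orthogonal_matrix (u x)"
  shows "partial_deriv \<mu> u x = u x ** frame_coupling u x \<mu>"
  unfolding frame_coupling_def by (simp add: orthogonal_matrixD[OF assms])

text \<open>
  The derivative of \<open>D = u\<^sup>T Q w\<close> is \<open>B\<^sub>u\<^sup>T D + D B\<^sub>w\<close>.  For \<open>u = w\<close> and \<open>Q = 1\<close> it expresses
  that couplings are skew-symmetric; for general \<open>Q\<close> it links the couplings of intertwined families.
\<close>

lemma partial_deriv_transpose_mult:
  assumes "u differentiable (at x)" "w differentiable (at x)"
    and "orthogonal_matrix (u x)" "orthogonal_matrix (w x)"
  shows "(\<lambda>y. transpose (u y) ** Q ** w y) differentiable (at x)"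
    and "partial_deriv \<mu> (\<lambda>y. transpose (u y) ** Q ** w y) x =
     transpose (frame_coupling u x \<mu>) ** (transpose (u x) ** Q ** w x)
     + (transpose (u x) ** Q ** w x) ** frame_coupling w x \<mu>"
proof -
  have dt: "(\<lambda>y. transpose (u y)) differentiable (at x)"
    using bounded_linear.has_derivative[OF bounded_linear_transpose] assms(1)
    unfolding differentiable_def by blast
  have cd: "(\<lambda>y. Q) differentiable (at x)" by simp
  have "partial_deriv \<mu> (\<lambda>y. Q) x = 0"
    by (rule partial_deriv_locally_constant[OF cd open_UNIV]) auto
  then have tQ: "(\<lambda>y. transpose (u y) ** Q) differentiable (at x)"
    "partial_deriv \<mu> (\<lambda>y. transpose (u y) ** Q) x = transpose (partial_deriv \<mu> u x) ** Q"
    using partial_deriv_matrix_mult[OF dt cd] partial_deriv_linear[OF assms(1) bounded_linear_transpose, of \<mu>]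
    by (simp_all add: bounded_bilinear.zero_right[OF bounded_bilinear_matrix_mult])
  show "(\<lambda>y. transpose (u y) ** Q ** w y) differentiable (at x)"
    using partial_deriv_matrix_mult(1)[OF tQ(1) assms(2)] .
  show "partial_deriv \<mu> (\<lambda>y. transpose (u y) ** Q ** w y) x =
     transpose (frame_coupling u x \<mu>) ** (transpose (u x) ** Q ** w x)
     + (transpose (u x) ** Q ** w x) ** frame_coupling w x \<mu>"
    unfolding partial_deriv_matrix_mult(2)[OF tQ(1) assms(2)] tQ(2) frame_coupling_def
    by (simp add: matrix_transpose_mul orthogonal_matrixD[OF assms(3)] orthogonal_matrixD[OF assms(4)]
        flip: matrix_mul_assoc)
qed

lemma frame_coupling_skew:
  assumes "ordered_C1_eigenframe U H u" "open U" "x \<in> U"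
  shows "frame_coupling u x \<mu> \<in> Skew"
proof -
  have o: "orthogonal_matrix (u y)" if "y \<in> U" for y
    using assms that unfolding ordered_C1_eigenframe_def by auto
  have d: "u differentiable (at x)"
    using assms C1_on_differentiable unfolding ordered_C1_eigenframe_def by auto
  have "partial_deriv \<mu> (\<lambda>y. transpose (u y) ** mat 1 ** u y) x = 0"
    by (rule partial_deriv_locally_constant[OF partial_deriv_transpose_mult(1)[OF d d] \<open>open U\<close>, where c = "mat 1"])
      (use o assms orthogonal_matrixD in auto)
  then have "transpose (frame_coupling u x \<mu>) + frame_coupling u x \<mu> = 0"
    unfolding partial_deriv_transpose_mult(2)[OF d d o[OF \<open>x \<in> U\<close>] o[OF \<open>x \<in> U\<close>]]
    using orthogonal_matrixD(1)[OF o[OF \<open>x \<in> U\<close>]] by simp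
  then show ?thesis unfolding Skew_def by (simp add: eq_neg_iff_add_eq_0)
qed

text \<open>
  In eigenframes an intertwiner \<open>Q\<close> becomes \<open>D = u\<^sup>T Q w\<close>, which commutes with a diagonal matrix
  with distinct entries and is orthogonal; hence it is a diagonal matrix of signs at every point of
  \<open>W\<close>.  Differentiating the vanishing off-diagonal entries relates the couplings.
\<close>

lemma frame_intertwiner:
  fixes u w :: "real^'m \<Rightarrow> 'n::{finite,linorder} sq_matrix"
  assumes u: "ordered_C1_eigenframe U H u" and w: "ordered_C1_eigenframe V K w"
    and "open W" "x \<in> W" "W \<subseteq> U" "W \<subseteq> V" and Q: "orthogonal_matrix Q"
    and ev: "\<forall>y\<in>W. ordered_eigenvalue (K y) = ordered_eigenvalue (H y)"
    and QK: "\<forall>y\<in>W. H y ** Q = Q ** K y"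
  shows "\<exists>d. (\<forall>n. d n * d n = 1) \<and> Q ** w x = u x ** diag d \<and>
    (\<forall>\<mu> m n. frame_coupling u x \<mu> $ m $ n * d n = d m * frame_coupling w x \<mu> $ m $ n)"
proof -
  define D where "D y = transpose (u y) ** Q ** w y" for y
  have ou: "orthogonal_matrix (u y)" and ow: "orthogonal_matrix (w y)" if "y \<in> W" for y
    using u w that assms(5,6) unfolding ordered_C1_eigenframe_def by auto
  have du: "u differentiable (at x)" and dw: "w differentiable (at x)"
    using u w assms(4-6) C1_on_differentiable[of U u x] C1_on_differentiable[of V w x]
    unfolding ordered_C1_eigenframe_def by auto
  have off: "D y $ m $ n = 0" if "y \<in> W" "m \<noteq> n" for y m n
  proof -
    let ?L = "diag (ordered_eigenvalue (H y))"
    have eu: "transpose (u y) ** H y = ?L ** transpose (u y)"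
      using frame_eigen_equation[OF u, of y] ou[OF that(1)] assms(5) that(1) u
      unfolding ordered_C1_eigenframe_def
      by (metis matrix_mul_assoc matrix_mul_rid orthogonal_matrixD(2) subsetD)
    have ew: "K y ** w y = w y ** ?L"
      using frame_eigen_equation[OF w, of y] bspec[OF ev that(1)] assms(6) that(1) by (metis subsetD)
    have "?L ** D y = transpose (u y) ** H y ** Q ** w y"
      unfolding D_def by (simp add: eu matrix_mul_assoc)
    also have "\<dots> = transpose (u y) ** (H y ** Q) ** w y"
      by (simp add: matrix_mul_assoc)
    also have "\<dots> = transpose (u y) ** Q ** (K y ** w y)"
      unfolding bspec[OF QK that(1)] by (simp add: matrix_mul_assoc)
    also have "\<dots> = D y ** ?L"
      unfolding ew D_def by (simp add: matrix_mul_assoc)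
    finally have "(?L ** D y) $ m $ n = (D y ** ?L) $ m $ n" by simp
    then have "ordered_eigenvalue (H y) m * D y $ m $ n = D y $ m $ n * ordered_eigenvalue (H y) n"
      by (simp only: diag_mult_nth mult_diag_nth)
    moreover have "strict_mono (ordered_eigenvalue (H y))"
      using u that assms(5) unfolding ordered_C1_eigenframe_def by blast
    then have "ordered_eigenvalue (H y) m \<noteq> ordered_eigenvalue (H y) n"
      using that(2) by (simp add: strict_mono_eq)
    ultimately show ?thesis by (simp add: mult.commute)
  qed
  define d where "d n = D x $ n $ n" for n
  have D: "D x = diag d"
    using off[OF \<open>x \<in> W\<close>] unfolding diag_def d_def vec_eq_iff by auto
  have Dd: "D differentiable (at x)"
    "partial_deriv \<mu> D x = transpose (frame_coupling u x \<mu>) ** D x + D x ** frame_coupling w x \<mu>" for \<mu>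
    unfolding D_def[abs_def]
    using partial_deriv_transpose_mult[OF du dw ou[OF \<open>x \<in> W\<close>] ow[OF \<open>x \<in> W\<close>]] by auto
  show ?thesis
  proof (intro exI[of _ d] conjI allI)
    have "orthogonal_matrix (D x)"
      unfolding D_def using ou[OF \<open>x \<in> W\<close>] ow[OF \<open>x \<in> W\<close>] Q
      by (intro orthogonal_matrix_mul) auto
    then have "diag d ** diag d = mat 1"
      using orthogonal_matrixD(1) by (metis D transpose_diag)
    then have "(diag d ** diag d) $ n $ n = 1" for n by (simp add: mat_def)
    then show "d n * d n = 1" for n by (simp only: diag_mult_nth) (simp add: diag_def)
    show "Q ** w x = u x ** diag d"
      using D orthogonal_matrixD(4)[OF ou[OF \<open>x \<in> W\<close>]] unfolding D_def
      by (metis matrix_mul_assoc)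
    have skew: "frame_coupling u x \<mu> \<in> Skew" "frame_coupling w x \<mu> \<in> Skew" for \<mu>
      using frame_coupling_skew[OF ordered_C1_eigenframe_subset \<open>open W\<close> \<open>x \<in> W\<close>] u w assms(5,6)
      by blast+
    show "frame_coupling u x \<mu> $ m $ n * d n = d m * frame_coupling w x \<mu> $ m $ n" for \<mu> m n
    proof (cases "m = n")
      case True
      then show ?thesis
        using Skew_nth[OF skew(1)[of \<mu>], of m m] Skew_nth[OF skew(2)[of \<mu>], of m m] by simp
    next
      case False
      have lin: "bounded_linear (\<lambda>A :: 'n sq_matrix. A $ m $ n)"
        by (intro bounded_linear_compose[OF bounded_linear_vec_nth bounded_linear_vec_nth])
      have "(\<lambda>y. D y $ m $ n) differentiable (at x)"
        using Dd(1) bounded_linear.has_derivative[OF lin] unfolding differentiable_def by blast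
      then have "partial_deriv \<mu> (\<lambda>y. D y $ m $ n) x = 0"
        by (rule partial_deriv_locally_constant[OF _ \<open>open W\<close> \<open>x \<in> W\<close>]) (use off False in auto)
      then have "partial_deriv \<mu> D x $ m $ n = 0"
        using partial_deriv_linear[OF Dd(1) lin] by metis
      then have "transpose (frame_coupling u x \<mu>) $ m $ n * d n + d m * frame_coupling w x \<mu> $ m $ n = 0"
        unfolding Dd(2) D by (simp add: diag_mult_nth mult_diag_nth)
      then show ?thesis
        using Skew_nth[OF skew(1)[of \<mu>], of m n] by (simp add: transpose_def)
    qed
  qed
qed

section \<open>Uniqueness of couplings and of intertwiners\<close>

lemma intertwined_frame_couplings_sign_conjugate:
  fixes u w :: "real^'m \<Rightarrow> 'n::{finite,linorder} sq_matrix"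
  assumes "ordered_C1_eigenframe U H u" "ordered_C1_eigenframe V K w"
    and "open W" "x \<in> W" "W \<subseteq> U" "W \<subseteq> V" "orthogonal_matrix Q"
    and "\<forall>y\<in>W. ordered_eigenvalue (K y) = ordered_eigenvalue (H y)"
    and "\<forall>y\<in>W. H y ** Q = Q ** K y"
  shows "sign_conjugate (frame_coupling u x) (frame_coupling w x)"
proof -
  obtain d where d1: "\<forall>n. d n * d n = 1" and
    d2: "\<forall>\<mu> m n. frame_coupling u x \<mu> $ m $ n * d n = d m * frame_coupling w x \<mu> $ m $ n"
    using frame_intertwiner[OF assms] by (elim exE conjE)
  note d = d1[rule_format] d2[rule_format]
  have "frame_coupling w x \<mu> $ m $ n = d m * d n * frame_coupling u x \<mu> $ m $ n" for \<mu> m n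
  proof -
    have "d m * d n * frame_coupling u x \<mu> $ m $ n = d m * (frame_coupling u x \<mu> $ m $ n * d n)"
      by (simp only: mult_ac)
    also have "\<dots> = d m * d m * frame_coupling w x \<mu> $ m $ n"
      unfolding d(2) by (simp only: mult_ac)
    finally show ?thesis by (simp add: d(1))
  qed
  then show ?thesis unfolding sign_conjugate_def by (intro exI[of _ d] conjI allI d(1))
qed

lemma derivative_couplingE:
  assumes "derivative_coupling X H A" "x \<in> X"
  obtains U u where "open U" "x \<in> U" "U \<subseteq> X" "ordered_C1_eigenframe U H u" "A x = frame_coupling u x"
proof -
  obtain U u where U: "open U" "x \<in> U" "U \<subseteq> X" "ordered_C1_eigenframe U H u"
    and A: "\<forall>\<mu>. A x \<mu> = transpose (u x) ** partial_deriv \<mu> u x"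
    using bspec[OF assms(1)[unfolded derivative_coupling_def] assms(2), THEN conjunct2]
    by (elim exE conjE)
  have "A x = frame_coupling u x"
    using A unfolding frame_coupling_def by (intro ext) simp
  with U show thesis by (rule that)
qed

lemma derivative_coupling_sign_conjugate_frame:
  fixes A :: "real^'m \<Rightarrow> 'm \<Rightarrow> 'n::{finite,linorder} sq_matrix"
  assumes "derivative_coupling X H A" "x \<in> X" "open U" "x \<in> U" "ordered_C1_eigenframe U H u"
  shows "sign_conjugate (A x) (frame_coupling u x)"
proof -
  obtain V w where V: "open V" "x \<in> V" "V \<subseteq> X" "ordered_C1_eigenframe V H w" "A x = frame_coupling w x"
    by (rule derivative_couplingE[OF assms(1,2)])
  have "sign_conjugate (frame_coupling w x) (frame_coupling u x)"
  proof (rule intertwined_frame_couplings_sign_conjugate[OF V(4) assms(5)])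
    show "open (U \<inter> V)" "x \<in> U \<inter> V" using V(1,2) assms(3,4) by auto
    show "U \<inter> V \<subseteq> V" "U \<inter> V \<subseteq> U" by auto
    show "orthogonal_matrix (mat 1 :: 'n sq_matrix)" by (rule orthogonal_matrix_id)
  qed simp_all
  then show ?thesis using V(5) by simp
qed

lemma gauge_equivalent_imp_sign_conjugate:
  fixes H K :: "real^'m \<Rightarrow> 'n::{finite,linorder} sq_matrix"
  assumes "gauge_equivalent X H K" "derivative_coupling X H A" "derivative_coupling X K B" "x \<in> X"
  shows "ordered_eigenvalue (K x) = ordered_eigenvalue (H x)" "sign_conjugate (A x) (B x)"
proof -
  obtain Q where Q: "orthogonal_matrix Q" and K0: "\<forall>y\<in>X. K y = transpose Q ** H y ** Q"
    using assms(1) unfolding gauge_equivalent_def by (elim exE conjE)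
  have K: "K y = transpose Q ** H y ** Q" if "y \<in> X" for y using bspec[OF K0 that] .
  have ev: "ordered_eigenvalue (K y) = ordered_eigenvalue (H y)" if "y \<in> X" for y
    unfolding K[OF that] by (rule ordered_eigenvalue_orthogonal_conjugate[OF Q])
  then show "ordered_eigenvalue (K x) = ordered_eigenvalue (H x)" using assms(4) .
  obtain U u where U: "open U" "x \<in> U" "U \<subseteq> X" "ordered_C1_eigenframe U H u" "A x = frame_coupling u x"
    by (rule derivative_couplingE[OF assms(2,4)])
  obtain V w where V: "open V" "x \<in> V" "V \<subseteq> X" "ordered_C1_eigenframe V K w" "B x = frame_coupling w x"
    by (rule derivative_couplingE[OF assms(3,4)])
  show "sign_conjugate (A x) (B x)"
    unfolding U(5) V(5)
  proof (rule intertwined_frame_couplings_sign_conjugate[OF U(4) V(4) _ _ _ _ Q])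
    show "open (U \<inter> V)" "x \<in> U \<inter> V" "U \<inter> V \<subseteq> U" "U \<inter> V \<subseteq> V" using U V by auto
    have UX: "y \<in> X" if "y \<in> U \<inter> V" for y using that U by auto
    show "\<forall>y\<in>U \<inter> V. ordered_eigenvalue (K y) = ordered_eigenvalue (H y)"
      by (intro ballI ev UX)
    show "\<forall>y\<in>U \<inter> V. H y ** Q = Q ** K y"
    proof
      fix y assume y: "y \<in> U \<inter> V"
      show "H y ** Q = Q ** K y"
        unfolding K[OF UX[OF y]] by (simp add: orthogonal_matrixD(4)[OF Q] flip: matrix_mul_assoc)
    qed
  qed
qed

text \<open>
  In the frame \<open>u\<close> the matrix \<open>C\<close> becomes a diagonal sign matrix that commutes with the coupling of
  \<open>u\<close>.  Its entries agree along every edge of the interaction graph, hence everywhere.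
\<close>

lemma local_commutant_trivial:
  fixes u :: "real^'m \<Rightarrow> 'n::{finite,linorder} sq_matrix"
  assumes u: "ordered_C1_eigenframe U H u" and W: "open W" "x \<in> W" "W \<subseteq> U"
    and conn: "connected_graph (interaction_edges (frame_coupling u x))"
    and C: "orthogonal_matrix C" "\<forall>y\<in>W. H y ** C = C ** H y"
  obtains c where "c * c = 1" "C = c *\<^sub>R mat 1"
proof -
  obtain d where d1: "\<forall>n. d n * d n = 1" and Cu: "C ** u x = u x ** diag d" and
    d2: "\<forall>\<mu> m n. frame_coupling u x \<mu> $ m $ n * d n = d m * frame_coupling u x \<mu> $ m $ n"
    using frame_intertwiner[OF u u W(1,2,3,3) C(1) ballI[OF refl] C(2)] by (elim exE conjE)
  note d = d1[rule_format] Cu d2[rule_format]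
  have skew: "frame_coupling u x \<mu> \<in> Skew" for \<mu>
    using frame_coupling_skew[OF ordered_C1_eigenframe_subset[OF u W(3)] W(1,2)] .
  have step: "d m = d n" if e: "{m, n} \<in> interaction_edges (frame_coupling u x)" for m n
  proof -
    obtain \<mu> where "frame_coupling u x \<mu> $ m $ n \<noteq> 0"
      using iffD1[OF interaction_edges_iff[of "frame_coupling u x", OF skew] e] by (elim exE)
    then show ?thesis using d(3)[of \<mu> m n] by simp
  qed
  define c where "c = d undefined"
  have "d n = c" for n
    unfolding c_def using connected_graph_constant[OF conn step] .
  then have "diag d = c *\<^sub>R mat 1"
    unfolding diag_def mat_def vec_eq_iff by simp
  then have "C ** u x = c *\<^sub>R u x"
    using d(2) by (simp add: bounded_bilinear.scaleR_right[OF bounded_bilinear_matrix_mult])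
  then have "C ** u x ** transpose (u x) = c *\<^sub>R (u x ** transpose (u x))"
    by (simp add: bounded_bilinear.scaleR_left[OF bounded_bilinear_matrix_mult])
  moreover have "orthogonal_matrix (u x)"
    using u W unfolding ordered_C1_eigenframe_def by blast
  then have "u x ** transpose (u x) = mat 1" by (rule orthogonal_matrixD(2))
  ultimately have "C = c *\<^sub>R mat 1" by (simp flip: matrix_mul_assoc)
  moreover have "c * c = 1" unfolding c_def by (rule d(1))
  ultimately show thesis by (intro that)
qed

section \<open>From sign conjugate couplings to a local gauge\<close>

lemma unit_squares_close_eq:
  fixes a b :: real
  assumes "a * a = 1" "b * b = 1" "\<bar>a - b\<bar> < 1"
  shows "a = b"
proof -
  have "a = 1 \<or> a = -1" "b = 1 \<or> b = -1"
    using assms(1,2) by (simp_all flip: power2_eq_square add: power2_eq_1_iff)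
  then show ?thesis using assms(3) by auto
qed

text \<open>
  The signs at different points are unrelated choices, and they are determined only up to a common
  factor.  What is determined on an edge \<open>{m, n}\<close> of the graph at \<open>x\<close> is the product \<open>s\<^sub>m s\<^sub>n\<close>, a
  quotient of entries of \<open>G\<close> and \<open>F\<close>.  It is continuous near \<open>x\<close> and takes only the values \<open>1\<close> and
  \<open>-1\<close>, so it is constant near \<open>x\<close>.  Connectedness extends this from the edges to all pairs.
\<close>

lemma sign_conjugate_locally_constant:
  fixes F G :: "'a::metric_space \<Rightarrow> 'm::finite \<Rightarrow> 'n::finite sq_matrix"
  assumes U: "open U" "x \<in> U"
    and cF: "\<And>\<mu>. continuous_on U (\<lambda>y. F y \<mu>)" and cG: "\<And>\<mu>. continuous_on U (\<lambda>y. G y \<mu>)"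
    and conj: "\<And>y. y \<in> U \<Longrightarrow> sign_conjugate (F y) (G y)"
    and skew: "\<And>\<mu>. F x \<mu> \<in> Skew"
    and conn: "connected_graph (interaction_edges (F x))"
  obtains s where "\<And>n. s n * s n = 1"
    "\<forall>\<^sub>F y in nhds x. \<forall>\<mu> m n. G y \<mu> $ m $ n = s m * s n * F y \<mu> $ m $ n"
proof -
  obtain s where s: "\<And>y n. y \<in> U \<Longrightarrow> s y n * s y n = 1"
    and G: "\<And>y \<mu> m n. y \<in> U \<Longrightarrow> G y \<mu> $ m $ n = s y m * s y n * F y \<mu> $ m $ n"
  proof -
    have "\<forall>y\<in>U. \<exists>s. (\<forall>n. s n * s n = 1) \<and> (\<forall>\<mu> m n. G y \<mu> $ m $ n = s m * s n * F y \<mu> $ m $ n)"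
      using conj unfolding sign_conjugate_def by blast
    then obtain s where "\<forall>y\<in>U. (\<forall>n. s y n * s y n = 1) \<and>
        (\<forall>\<mu> m n. G y \<mu> $ m $ n = s y m * s y n * F y \<mu> $ m $ n)"
      by (rule bchoice[THEN exE])
    then show thesis using that[of s] by blast
  qed
  have nearU: "\<forall>\<^sub>F y in nhds x. y \<in> U" using U eventually_nhds by blast
  have edge: "\<forall>\<^sub>F y in nhds x. {m, n} \<in> interaction_edges (F x) \<longrightarrow> s y m * s y n = s x m * s x n"
    for m n
  proof (cases "{m, n} \<in> interaction_edges (F x)")
    case True
    obtain \<mu> where nz: "F x \<mu> $ m $ n \<noteq> 0"
      using iffD1[OF interaction_edges_iff[of "F x", OF skew] True] by (elim exE)
    have tF: "((\<lambda>y. F y \<mu> $ m $ n) \<longlongrightarrow> F x \<mu> $ m $ n) (nhds x)"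
      and tG: "((\<lambda>y. G y \<mu> $ m $ n) \<longlongrightarrow> G x \<mu> $ m $ n) (nhds x)"
      using cF[of \<mu>] cG[of \<mu>] U
      by (auto simp: continuous_on_eq_continuous_at continuous_at intro!: tendsto_vec_nth
          dest: tendsto_at_iff_tendsto_nhds[THEN iffD1])
    have "((\<lambda>y. G y \<mu> $ m $ n / F y \<mu> $ m $ n) \<longlongrightarrow> G x \<mu> $ m $ n / F x \<mu> $ m $ n) (nhds x)"
      using tF tG nz by (intro tendsto_divide)
    then have "\<forall>\<^sub>F y in nhds x. dist (G y \<mu> $ m $ n / F y \<mu> $ m $ n) (G x \<mu> $ m $ n / F x \<mu> $ m $ n) < 1"
      by (rule tendstoD) simp
    moreover have "\<forall>\<^sub>F y in nhds x. F y \<mu> $ m $ n \<noteq> 0"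
      using tendsto_imp_eventually_ne[OF tF nz] .
    ultimately have "\<forall>\<^sub>F y in nhds x. s y m * s y n = s x m * s x n"
      using nearU
    proof eventually_elim
      case (elim y)
      have sq: "(s z m * s z n) * (s z m * s z n) = 1" if "z \<in> U" for z
      proof -
        have "(s z m * s z n) * (s z m * s z n) = (s z m * s z m) * (s z n * s z n)"
          by (simp only: mult_ac)
        then show ?thesis unfolding s[OF that] by simp
      qed
      have "\<bar>s y m * s y n - s x m * s x n\<bar> < 1"
        using elim(1,2) nz G[OF elim(3), of \<mu> m n] G[OF U(2), of \<mu> m n] by (simp add: dist_real_def)
      with sq[OF elim(3)] sq[OF U(2)] show ?case by (rule unit_squares_close_eq)
    qed
    then show ?thesis by eventually_elim simp
  qed simp
  have "\<forall>\<^sub>F y in nhds x. \<forall>m n. {m, n} \<in> interaction_edges (F x) \<longrightarrow> s y m * s y n = s x m * s x n"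
    by (intro eventually_all_finite edge)
  then have "\<forall>\<^sub>F y in nhds x. \<forall>\<mu> m n. G y \<mu> $ m $ n = s x m * s x n * F y \<mu> $ m $ n"
    using nearU
  proof eventually_elim
    case (elim y)
    \<comment> \<open>The change of sign from \<open>x\<close> to \<open>y\<close> is the same at all vertices.\<close>
    have const: "s y m * s x m = s y n * s x n" for m n
    proof (rule connected_graph_constant[OF conn])
      fix a b assume "{a, b} \<in> interaction_edges (F x)"
      then have ab: "s y a * s y b = s x a * s x b" using elim(1) by blast
      have "s y a * s x a = (s y b * s y b) * (s y a * s x a)" using s[OF elim(2)] by simp
      also have "\<dots> = (s y a * s y b) * (s y b * s x a)" by (simp only: mult_ac)
      also have "\<dots> = (s x a * s x a) * (s y b * s x b)" unfolding ab by (simp only: mult_ac)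
      finally show "s y a * s x a = s y b * s x b" using s[OF U(2)] by simp
    qed
    have "s y m * s y n = s x m * s x n" for m n
    proof -
      have "s y m * s y n = (s y m * s x m) * (s x m * s y n)"
        using s[OF U(2), of m] by (simp add: mult.assoc mult.left_commute)
      also have "\<dots> = (s y n * s y n) * (s x m * s x n)"
        unfolding const[of m n] by (simp only: mult_ac)
      finally show ?thesis using s[OF elim(2)] by simp
    qed
    then show ?case using G[OF elim(2)] by simp
  qed
  then show thesis using that s[OF U(2)] by blast
qed

lemma continuous_on_frame_coupling:
  assumes "ordered_C1_eigenframe U H u"
  shows "continuous_on U (\<lambda>y. frame_coupling u y \<mu>)"
proof -
  have C1: "C1_on U u" using assms unfolding ordered_C1_eigenframe_def by blast
  then obtain u' where "\<And>x. x \<in> U \<Longrightarrow> (u has_derivative blinfun_apply (u' x)) (at x)"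
    unfolding C1_on_def by blast
  then have "continuous_on U u"
    by (meson continuous_at_imp_continuous_on has_derivative_continuous)
  then show ?thesis
    unfolding frame_coupling_def
    by (intro bounded_bilinear.continuous_on[OF bounded_bilinear_matrix_mult]
        bounded_linear.continuous_on[OF bounded_linear_transpose] C1_on_continuous_partial_deriv C1)
qed

text \<open>
  Once the signs are constant, \<open>R = u S w\<^sup>T\<close> has derivative \<open>u (B\<^sub>u S + S B\<^sub>w\<^sup>T) w\<^sup>T\<close>, which vanishes
  by skew-symmetry and \<open>B\<^sub>w = S B\<^sub>u S\<close>.  The constant matrix \<open>R\<close> carries one eigenframe to the other
  up to signs, and signs do not affect the diagonalised family.
\<close>

lemma sign_conjugate_imp_local_gauge:
  fixes u w :: "real^'m \<Rightarrow> 'n::{finite,linorder} sq_matrix"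
  assumes u: "ordered_C1_eigenframe U H u" and w: "ordered_C1_eigenframe U K w"
    and U: "open U" "x \<in> U"
    and ev: "\<And>y. y \<in> U \<Longrightarrow> ordered_eigenvalue (K y) = ordered_eigenvalue (H y)"
    and conj: "\<And>y. y \<in> U \<Longrightarrow> sign_conjugate (frame_coupling u y) (frame_coupling w y)"
    and conn: "connected_graph (interaction_edges (frame_coupling u x))"
  shows "\<exists>e Q. 0 < e \<and> orthogonal_matrix Q \<and> ball x e \<subseteq> U \<and>
    (\<forall>y\<in>ball x e. K y = transpose Q ** H y ** Q)"
proof -
  have ou: "orthogonal_matrix (u y)" and ow: "orthogonal_matrix (w y)" if "y \<in> U" for y
    using u w that unfolding ordered_C1_eigenframe_def by auto
  have du: "u differentiable (at y)" and dw: "w differentiable (at y)" if "y \<in> U" for y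
    using u w that C1_on_differentiable[of U u y] C1_on_differentiable[of U w y]
    unfolding ordered_C1_eigenframe_def by auto
  obtain s where s: "\<And>n. s n * s n = 1"
    and near: "\<forall>\<^sub>F y in nhds x. \<forall>\<mu> m n.
      frame_coupling w y \<mu> $ m $ n = s m * s n * frame_coupling u y \<mu> $ m $ n"
    using sign_conjugate_locally_constant[OF U, of "frame_coupling u" "frame_coupling w"]
      continuous_on_frame_coupling[OF u] continuous_on_frame_coupling[OF w]
      conj conn frame_coupling_skew[OF u U] by blast
  have "\<forall>\<^sub>F y in nhds x. y \<in> U" using U eventually_nhds by blast
  with near have "\<forall>\<^sub>F y in nhds x. y \<in> U \<and> (\<forall>\<mu> m n.
      frame_coupling w y \<mu> $ m $ n = s m * s n * frame_coupling u y \<mu> $ m $ n)"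
    by eventually_elim simp
  then obtain e where e: "0 < e" and ball: "\<And>y. dist y x < e \<Longrightarrow> y \<in> U \<and> (\<forall>\<mu> m n.
      frame_coupling w y \<mu> $ m $ n = s m * s n * frame_coupling u y \<mu> $ m $ n)"
    unfolding eventually_nhds_metric by blast
  have bU: "y \<in> U"
    and B: "frame_coupling w y \<mu> $ m $ n = s m * s n * frame_coupling u y \<mu> $ m $ n"
    if "y \<in> ball x e" for y \<mu> m n
    using ball[of y] that by (auto simp: dist_commute)
  let ?S = "diag s"
  define R where "R y = u y ** (?S ** transpose (w y))" for y
  have R: "R differentiable (at y)" "partial_deriv \<mu> R y = 0" if y: "y \<in> ball x e" for y \<mu>
  proof -
    note yU = bU[OF y]
    let ?B = "frame_coupling u y \<mu>" and ?B' = "frame_coupling w y \<mu>"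
    have lin: "bounded_linear (\<lambda>A :: 'n sq_matrix. ?S ** transpose A)"
      by (intro bounded_linear_compose[OF bounded_bilinear.bounded_linear_right[OF bounded_bilinear_matrix_mult]
            bounded_linear_transpose])
    have dSw: "(\<lambda>y. ?S ** transpose (w y)) differentiable (at y)"
      using bounded_linear.has_derivative[OF lin] dw[OF yU] unfolding differentiable_def by blast
    show "R differentiable (at y)"
      unfolding R_def[abs_def] by (rule partial_deriv_matrix_mult(1)[OF du[OF yU] dSw])
    have "partial_deriv \<mu> R y = u y ** ?B ** (?S ** transpose (w y)) + u y ** (?S ** transpose (w y ** ?B'))"
      unfolding R_def[abs_def] partial_deriv_matrix_mult(2)[OF du[OF yU] dSw]
        partial_deriv_linear[OF dw[OF yU] lin]
        partial_deriv_frame[of u, OF ou[OF yU]] partial_deriv_frame[of w, OF ow[OF yU]] ..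
    also have "\<dots> = u y ** (?B ** ?S + ?S ** transpose ?B') ** transpose (w y)"
      by (simp add: matrix_transpose_mul matrix_mul_assoc
          bounded_bilinear.add_left[OF bounded_bilinear_matrix_mult] matrix_add_ldistrib)
    also have "?B ** ?S + ?S ** transpose ?B' = 0"
    proof -
      have "(?B ** ?S) $ m $ n + (?S ** transpose ?B') $ m $ n = 0" for m n
      proof -
        have "(?S ** transpose ?B') $ m $ n = s m * (s n * s m * ?B $ n $ m)"
          unfolding diag_mult_nth by (simp add: transpose_def B[OF y])
        also have "\<dots> = (s m * s m) * (s n * ?B $ n $ m)" by (simp only: mult_ac)
        also have "?B $ n $ m = - ?B $ m $ n"
          by (rule Skew_nth[OF frame_coupling_skew[OF u U(1) yU]])
        finally show ?thesis unfolding mult_diag_nth s by simp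
      qed
      then show ?thesis by (simp add: vec_eq_iff)
    qed
    finally show "partial_deriv \<mu> R y = 0"
      by (simp add: bounded_bilinear.zero_left[OF bounded_bilinear_matrix_mult]
          bounded_bilinear.zero_right[OF bounded_bilinear_matrix_mult])
  qed
  have SS: "?S ** ?S = mat 1"
  proof -
    have "(?S ** ?S) $ m $ n = mat 1 $ m $ n" for m n
      unfolding diag_mult_nth by (simp add: diag_def mat_def s)
    then show ?thesis by (simp add: vec_eq_iff)
  qed
  then have oS: "orthogonal_matrix ?S" unfolding orthogonal_matrix by (simp add: transpose_diag)
  have K: "K y = transpose (R x) ** H y ** R x" if y: "y \<in> ball x e" for y
  proof -
    note yU = bU[OF y]
    let ?L = "diag (ordered_eigenvalue (H y))"
    have "R x = R y"
      using e y by (intro zero_partial_derivs_imp_constant[of "ball x e"] R) auto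
    then have "transpose (R x) ** H y ** R x
        = w y ** (?S ** ((transpose (u y) ** (H y ** u y)) ** ?S)) ** transpose (w y)"
      by (simp add: R_def matrix_transpose_mul transpose_diag matrix_mul_assoc)
    also have "transpose (u y) ** (H y ** u y) = ?L"
      unfolding frame_eigen_equation[OF u yU] by (simp add: orthogonal_matrixD[OF ou[OF yU]])
    also have "?S ** (?L ** ?S) = ?L"
    proof -
      have "(?S ** (?L ** ?S)) $ m $ n = ?L $ m $ n" for m n
        unfolding diag_mult_nth by (simp add: diag_def mult.left_commute s)
      then show ?thesis by (simp add: vec_eq_iff)
    qed
    also have "w y ** ?L = K y ** w y"
      using frame_eigen_equation[OF w yU] ev[OF yU] by simp
    also have "K y ** w y ** transpose (w y) = K y"
      by (simp add: orthogonal_matrixD[OF ow[OF yU]] flip: matrix_mul_assoc)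
    finally show ?thesis ..
  qed
  have "orthogonal_matrix (R x)"
    unfolding R_def using ou[OF U(2)] ow[OF U(2)] oS by (intro orthogonal_matrix_mul) auto
  moreover have "ball x e \<subseteq> U" using bU by blast
  ultimately show ?thesis by (intro exI[of _ e] exI[of _ "R x"] conjI ballI e K)
qed

section \<open>Gluing local gauges\<close>

text \<open>
  The set of points near which a fixed \<open>Q\<close> is a gauge is open.  It is also closed in \<open>X\<close>: on a ball
  where some \<open>Q'\<close> is a gauge, a single point with the gauge \<open>Q\<close> nearby makes \<open>Q' Q\<^sup>T\<close> commute with
  \<open>H\<close> on an open set, so that \<open>Q' = c Q\<close> with \<open>c\<^sup>2 = 1\<close>, and then \<open>Q\<close> is a gauge on the whole ball.
\<close>

lemma local_gauges_glue:
  fixes H K :: "'a::metric_space \<Rightarrow> 'n::finite sq_matrix"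
  assumes "open X" "connected X"
    and loc: "\<And>x. x \<in> X \<Longrightarrow> \<exists>e Q. 0 < e \<and> orthogonal_matrix Q \<and> ball x e \<subseteq> X \<and>
      (\<forall>y\<in>ball x e. K y = transpose Q ** H y ** Q)"
    and commutant: "\<And>x W C. open W \<Longrightarrow> x \<in> W \<Longrightarrow> W \<subseteq> X \<Longrightarrow> orthogonal_matrix C \<Longrightarrow>
      (\<And>y. y \<in> W \<Longrightarrow> H y ** C = C ** H y) \<Longrightarrow> \<exists>c. c * c = 1 \<and> C = c *\<^sub>R mat 1"
  shows "gauge_equivalent X H K"
proof (cases "X = {}")
  case True
  then show ?thesis
    unfolding gauge_equivalent_def using orthogonal_matrix_id by blast
next
  case False
  then obtain x0 where x0: "x0 \<in> X" by blast
  obtain e0 Q where Q: "0 < e0" "orthogonal_matrix Q"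
      "\<forall>y\<in>ball x0 e0. K y = transpose Q ** H y ** Q"
    using loc[OF x0] by blast
  define P where "P z \<longleftrightarrow> (\<exists>W. open W \<and> z \<in> W \<and> (\<forall>y\<in>W. K y = transpose Q ** H y ** Q))" for z
  have "P x0" unfolding P_def using Q by (intro exI[of _ "ball x0 e0"]) auto
  have "P b" if "b \<in> X" for b
  proof (rule connected_induction_simple[where P = P, OF \<open>connected X\<close> x0 that \<open>P x0\<close>])
    fix a assume "a \<in> X"
    then obtain e Q' where e: "0 < e" "orthogonal_matrix Q'" "ball a e \<subseteq> X"
      and K': "\<And>y. y \<in> ball a e \<Longrightarrow> K y = transpose Q' ** H y ** Q'"
      using loc by blast
    have "P y" if x: "x \<in> ball a e" and y: "y \<in> ball a e" and "P x" for x y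
    proof -
      obtain W where W: "open W" "x \<in> W" "\<And>y. y \<in> W \<Longrightarrow> K y = transpose Q ** H y ** Q"
        using \<open>P x\<close> unfolding P_def by blast
      let ?C = "Q' ** transpose Q"
      have "\<exists>c. c * c = 1 \<and> ?C = c *\<^sub>R mat 1"
      proof (rule commutant)
        show "open (W \<inter> ball a e)" "x \<in> W \<inter> ball a e" "W \<inter> ball a e \<subseteq> X"
          using W x e by auto
        show "orthogonal_matrix ?C" using Q e by (intro orthogonal_matrix_mul) auto
        fix z assume "z \<in> W \<inter> ball a e"
        then have "transpose Q' ** H z ** Q' = transpose Q ** H z ** Q"
          using W(3)[of z] K'[of z] by simp
        then have "Q' ** (transpose Q' ** (H z ** Q')) ** transpose Q
            = Q' ** (transpose Q ** (H z ** Q)) ** transpose Q"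
          by (simp add: matrix_mul_assoc)
        then show "H z ** ?C = ?C ** H z"
          unfolding orthogonal_matrixD(4)[OF e(2)]
          by (simp add: orthogonal_matrixD(2)[OF Q(2)] flip: matrix_mul_assoc)
      qed
      then obtain c where c: "c * c = 1" "?C = c *\<^sub>R mat 1" by blast
      have "Q' = ?C ** Q"
        by (simp add: orthogonal_matrixD(1)[OF Q(2)] flip: matrix_mul_assoc)
      then have "Q' = c *\<^sub>R Q"
        unfolding c(2) by (simp add: bounded_bilinear.scaleR_left[OF bounded_bilinear_matrix_mult])
      then have KQ: "K z = transpose Q ** H z ** Q" if "z \<in> ball a e" for z
        using K'[OF that] c(1)
        by (simp add: bounded_bilinear.scaleR_left[OF bounded_bilinear_matrix_mult]
            bounded_bilinear.scaleR_right[OF bounded_bilinear_matrix_mult]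
            linear_cmul[OF bounded_linear.linear[OF bounded_linear_transpose]])
      show "P y"
        unfolding P_def by (intro exI[of _ "ball a e"] conjI ballI open_ball y KQ)
    qed
    then have "\<forall>x\<in>ball a e. \<forall>y\<in>ball a e. P x \<longrightarrow> P y" by blast
    moreover have "openin (top_of_set X) (ball a e)"
      using e(3) by (simp add: openin_open_eq[OF \<open>open X\<close>])
    moreover have "a \<in> ball a e" using e(1) by simp
    ultimately show "\<exists>T. openin (top_of_set X) T \<and> a \<in> T \<and> (\<forall>x\<in>T. \<forall>y\<in>T. P x \<longrightarrow> P y)"
      by blast
  qed
  then have "\<forall>b\<in>X. K b = transpose Q ** H b ** Q"
    unfolding P_def by blast
  then show ?thesis
    unfolding gauge_equivalent_def by (intro exI[of _ Q] conjI Q(2))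
qed

text \<open>
  Around each point both families have frames on a common neighbourhood, and at every point of it the
  couplings of these frames are sign conjugate to the given ones, hence to each other.
\<close>

lemma sign_conjugate_imp_gauge_equivalent:
  fixes H K :: "real^'m \<Rightarrow> 'n::{finite,linorder} sq_matrix"
  assumes "open X" "connected X"
    and A: "derivative_coupling X H A" and B: "derivative_coupling X K B"
    and conn: "\<And>x. x \<in> X \<Longrightarrow> connected_graph (interaction_edges (A x))"
    and ev: "\<And>x. x \<in> X \<Longrightarrow> ordered_eigenvalue (K x) = ordered_eigenvalue (H x)"
    and conj: "\<And>x. x \<in> X \<Longrightarrow> sign_conjugate (A x) (B x)"
  shows "gauge_equivalent X H K"
proof (rule local_gauges_glue[OF assms(1,2)])
  fix x assume x: "x \<in> X"
  obtain U u where U: "open U" "x \<in> U" "U \<subseteq> X" "ordered_C1_eigenframe U H u" "A x = frame_coupling u x"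
    by (rule derivative_couplingE[OF A x])
  obtain V w where V: "open V" "x \<in> V" "V \<subseteq> X" "ordered_C1_eigenframe V K w" "B x = frame_coupling w x"
    by (rule derivative_couplingE[OF B x])
  have frames: "ordered_C1_eigenframe (U \<inter> V) H u" "ordered_C1_eigenframe (U \<inter> V) K w"
    using U(4) V(4) ordered_C1_eigenframe_subset by blast+
  have UV: "open (U \<inter> V)" "x \<in> U \<inter> V" using U V by auto
  have "sign_conjugate (frame_coupling u y) (frame_coupling w y)" if y: "y \<in> U \<inter> V" for y
  proof -
    have yX: "y \<in> X" using y U by blast
    have 1: "sign_conjugate (frame_coupling u y) (A y)"
      by (rule sign_conjugate_sym[OF derivative_coupling_sign_conjugate_frame[OF A yX UV(1) y frames(1)]])
    have 2: "sign_conjugate (A y) (B y)"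
      by (rule conj[OF yX])
    have 3: "sign_conjugate (B y) (frame_coupling w y)"
      by (rule derivative_coupling_sign_conjugate_frame[OF B yX UV(1) y frames(2)])
    show ?thesis
      by (rule sign_conjugate_trans[OF sign_conjugate_trans[OF 1 2] 3])
  qed
  moreover have "ordered_eigenvalue (K y) = ordered_eigenvalue (H y)" if "y \<in> U \<inter> V" for y
    using ev that U by blast
  moreover have "connected_graph (interaction_edges (frame_coupling u x))"
    using conn[OF x] U(5) by simp
  ultimately have "\<exists>e Q. 0 < e \<and> orthogonal_matrix Q \<and> ball x e \<subseteq> U \<inter> V \<and>
      (\<forall>y\<in>ball x e. K y = transpose Q ** H y ** Q)"
    by (intro sign_conjugate_imp_local_gauge[OF frames UV])
  then obtain e Q where "0 < e" "orthogonal_matrix Q" and e: "ball x e \<subseteq> U \<inter> V"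
    and "\<forall>y\<in>ball x e. K y = transpose Q ** H y ** Q"
    by (elim exE conjE)
  moreover have "ball x e \<subseteq> X" using e U(3) by blast
  ultimately show "\<exists>e Q. 0 < e \<and> orthogonal_matrix Q \<and> ball x e \<subseteq> X \<and>
      (\<forall>y\<in>ball x e. K y = transpose Q ** H y ** Q)"
    by (intro exI[of _ e] exI[of _ Q] conjI)
next
  fix x W and C :: "'n sq_matrix"
  assume W: "open W" "x \<in> W" "W \<subseteq> X" and C: "orthogonal_matrix C" "\<And>y. y \<in> W \<Longrightarrow> H y ** C = C ** H y"
  have x: "x \<in> X" using W by blast
  obtain U u where U: "open U" "x \<in> U" "U \<subseteq> X" "ordered_C1_eigenframe U H u" "A x = frame_coupling u x"
    by (rule derivative_couplingE[OF A x])
  show "\<exists>c. c * c = 1 \<and> C = c *\<^sub>R mat 1"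
  proof (rule local_commutant_trivial[OF U(4), of "U \<inter> W" x C])
    show "connected_graph (interaction_edges (frame_coupling u x))"
      using conn[OF x] U(5) by simp
    show "open (U \<inter> W)" "x \<in> U \<inter> W" "U \<inter> W \<subseteq> U" using U(1,2) W(1,2) by auto
    show "\<forall>y\<in>U \<inter> W. H y ** C = C ** H y" by (intro ballI C(2)) simp
    show "orthogonal_matrix C" by (fact C(1))
    show "\<exists>c. c * c = 1 \<and> C = c *\<^sub>R mat 1" if "c * c = 1" "C = c *\<^sub>R mat 1" for c
      by (intro exI[of _ c] conjI that)
  qed
qed

theorem theorem2p1:
  fixes X :: "(real^'m) set"
    and H\<^sub>1 :: "real^'m \<Rightarrow> 'n::{finite,linorder} sq_matrix"
    and A\<^sub>1 :: "real^'m \<Rightarrow> 'm \<Rightarrow> 'n sq_matrix"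
    and l :: "real^'m \<Rightarrow> 'n set \<Rightarrow> 'm"
    and T :: "real^'m \<Rightarrow> 'n set set"
  assumes "open X" and "connected X"
    and "C1_nondegenerate_family X H\<^sub>1"
    and "derivative_coupling X H\<^sub>1 A\<^sub>1"
    and "\<forall>x\<in>X. connected_graph (interaction_edges (A\<^sub>1 x))"
    and "active_direction_selection X A\<^sub>1 l"
    and "\<forall>x\<in>X. spanning_tree (T x) (interaction_edges (A\<^sub>1 x))"
  shows "(\<forall>H\<^sub>2 A\<^sub>2. C1_nondegenerate_family X H\<^sub>2 \<and> derivative_coupling X H\<^sub>2 A\<^sub>2 \<longrightarrow>
            (gauge_equivalent X H\<^sub>1 H\<^sub>2 \<longleftrightarrow>
             (\<forall>x\<in>X. invariant_map A\<^sub>1 T l x H\<^sub>1 A\<^sub>1 = invariant_map A\<^sub>1 T l x H\<^sub>2 A\<^sub>2))) \<and>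
         (\<forall>H A. C1_nondegenerate_family X H \<and> derivative_coupling X H A \<longrightarrow>
            (\<forall>x\<in>X. finite (invariant_map A\<^sub>1 T l x H A) \<and>
                   card (invariant_map A\<^sub>1 T l x H A) \<le> CARD('m) * CARD('n)\<^sup>2))"
proof (intro conjI allI impI ballI iffI)
  fix H\<^sub>2 :: "real^'m \<Rightarrow> 'n sq_matrix" and A\<^sub>2 x
  assume "C1_nondegenerate_family X H\<^sub>2 \<and> derivative_coupling X H\<^sub>2 A\<^sub>2"
    and "gauge_equivalent X H\<^sub>1 H\<^sub>2" and x: "x \<in> X"
  then have "ordered_eigenvalue (H\<^sub>1 x) = ordered_eigenvalue (H\<^sub>2 x)" "sign_conjugate (A\<^sub>1 x) (A\<^sub>2 x)"
    using gauge_equivalent_imp_sign_conjugate[of X H\<^sub>1 H\<^sub>2 A\<^sub>1 A\<^sub>2 x] assms(4) by auto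
  then show "invariant_map A\<^sub>1 T l x H\<^sub>1 A\<^sub>1 = invariant_map A\<^sub>1 T l x H\<^sub>2 A\<^sub>2"
    unfolding invariant_map_def using bspec[OF assms(7) x] by (intro invariants_sign_conjugate)
next
  fix H\<^sub>2 :: "real^'m \<Rightarrow> 'n sq_matrix" and A\<^sub>2
  assume "C1_nondegenerate_family X H\<^sub>2 \<and> derivative_coupling X H\<^sub>2 A\<^sub>2"
  then have A2: "derivative_coupling X H\<^sub>2 A\<^sub>2" ..
  assume inv: "\<forall>x\<in>X. invariant_map A\<^sub>1 T l x H\<^sub>1 A\<^sub>1 = invariant_map A\<^sub>1 T l x H\<^sub>2 A\<^sub>2"
  show "gauge_equivalent X H\<^sub>1 H\<^sub>2"
  proof (rule sign_conjugate_imp_gauge_equivalent[OF assms(1,2,4) A2])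
    fix x assume x: "x \<in> X"
    have eq: "invariants (interaction_edges (A\<^sub>1 x)) (T x) (l x) (H\<^sub>1 x) (A\<^sub>1 x)
        = invariants (interaction_edges (A\<^sub>1 x)) (T x) (l x) (H\<^sub>2 x) (A\<^sub>2 x)"
      using inv x unfolding invariant_map_def by blast
    show "connected_graph (interaction_edges (A\<^sub>1 x))" using assms(5) x by blast
    show "ordered_eigenvalue (H\<^sub>2 x) = ordered_eigenvalue (H\<^sub>1 x)"
      using eq[unfolded invariants_eq_iff, THEN conjunct1] by (intro ext) simp
    show "sign_conjugate (A\<^sub>1 x) (A\<^sub>2 x)"
    proof (rule invariants_eq_imp_sign_conjugate[OF _ _ _ _ eq])
      show "spanning_tree (T x) (interaction_edges (A\<^sub>1 x))" using assms(7) x by blast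
      show "A\<^sub>1 x \<mu> \<in> Skew" "A\<^sub>2 x \<mu> \<in> Skew" for \<mu>
        using bspec[OF assms(4)[unfolded derivative_coupling_def] x]
          bspec[OF A2[unfolded derivative_coupling_def] x] by simp_all
      show "A\<^sub>1 x (l x {m, n}) $ m $ n \<noteq> 0" if "{m, n} \<in> interaction_edges (A\<^sub>1 x)" for m n
        using assms(6) x that unfolding active_direction_selection_def by blast
    qed
  qed
next
  fix H :: "real^'m \<Rightarrow> 'n sq_matrix" and A x
  show "finite (invariant_map A\<^sub>1 T l x H A)"
    "card (invariant_map A\<^sub>1 T l x H A) \<le> CARD('m) * CARD('n)\<^sup>2"
    unfolding invariant_map_def by (rule card_invariants)+
qed

end
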